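(* Let $X$ be a sequentially complete Hausdorff locally convex space and $(T(t))_{t\geq 0}$ a strongly continuous semigroup on $X$ with generator $(A,D(A))$. Then the following assertions hold for all $t\geq 0$. (a) $\mathrm{e}^{t\sigma_{\mathrm{alg}}(A)}\subseteq \sigma_{\mathrm{alg}}(T(t))$, (b) $\mathrm{e}^{t\sigma_{\mathrm{p}}(A)}\subseteq \sigma_{\mathrm{p}}(T(t))$, (c) $\mathrm{e}^{t\sigma_{\mathrm{r}}(A)}\subseteq \sigma_{\mathrm{r}}(T(t))$. If in addition $(T(t))_{t\geq 0}$ is locally equicontinuous, then the following assertions hold for all $t\geq 0$. (d) $\mathrm{e}^{t\sigma(A)}\subseteq \sigma(T(t))$, (e) $\mathrm{e}^{t\sigma_{\mathrm{ap}}(A)}\subseteq \sigma_{\mathrm{ap}}(T(t))$, (f) $\mathrm{e}^{t\sigma_{\mathrm{ap}}^{\mathrm{seq}}(A)}\subseteq \sigma_{\mathrm{ap}}^{\mathrm{seq}}(T(t))$, (g) $\mathrm{e}^{t\sigma_{\mathrm{bap}}(A)}\subseteq \sigma_{\mathrm{bap}}(T(t))$, (h) $\mathrm{e}^{t\sigma_{\mathrm{bap}}^{\mathrm{seq}}(A)}\subseteq \sigma_{\mathrm{bap}}^{\mathrm{seq}}(T(t))$, (i) $\mathrm{e}^{t\sigma^{\ast}(A)}\subseteq \sigma^{\ast}(T(t))$.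
   Context: All locally convex spaces have scalar field $\mathbb{C}$. $\Gamma_X$ denotes a fundamental system of seminorms inducing the topology of $X$ (every continuous seminorm is bounded by a constant multiple of a member of $\Gamma_X$), and $\mathcal{L}(X)$ the space of continuous linear operators $X\to X$. A semigroup on $X$ is a family $(T(t))_{t\geq 0}$ in $\mathcal{L}(X)$ with $T(0)=\mathrm{id}$ and $T(t+s)=T(t)T(s)$ for all $t,s\geq 0$. It is strongly continuous if $t\mapsto T(t)x$ is continuous $[0,\infty)\to X$ for every $x\in X$. It is locally equicontinuous if for all $q\in\Gamma_X$ and $t_0\geq 0$ there are $p\in\Gamma_X$, $C\geq 0$ with $q(T(t)x)\leq Cp(x)$ for all $t\in[0,t_0]$, $x\in X$. The generator $(A,D(A))$ is given by $Ax=\lim_{t\to 0+}\frac{T(t)x-x}{t}$ with $D(A)$ the set of all $x\in X$ for which this limit exists in $X$. For a linear operator $(A,D(A))$ on $X$ ($D(A)\subseteq X$ a linear subspace, $A\colon D(A)\to X$ linear) and $\lambda\in\mathbb{C}$ write $\lambda-A:=\lambda\,\mathrm{id}-A$ on $D(A)$ and $\operatorname{ran}(\lambda-A):=\{(\lambda-A)x\mid x\in D(A)\}$. Define: $\sigma_{\mathrm{alg}}(A):=\{\lambda\in\mathbb{C}\mid \lambda-A\colon D(A)\to X \text{ is not bijective}\}$; $\rho(A):=\{\lambda\in\mathbb{C}\mid\lambda-A\text{ is bijective and }(\lambda-A)^{-1}\in\mathcal{L}(X)\}$, $R(\lambda,A):=(\lambda-A)^{-1}$ for $\lambda\in\rho(A)$,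 $\sigma(A):=\mathbb{C}\setminus\rho(A)$; $\rho^{\ast}(A)$ is the set of all $\lambda\in\rho(A)$ for which there is $\delta>0$ such that $B(\lambda,\delta):=\{\mu\in\mathbb{C}\mid|\mu-\lambda|<\delta\}\subseteq\rho(A)$ and $\{R(\mu,A)\mid\mu\in B(\lambda,\delta)\}$ is equicontinuous in $\mathcal{L}(X)$; $\sigma^{\ast}(A):=\mathbb{C}\setminus\rho^{\ast}(A)$; $\sigma_{\mathrm{p}}(A):=\{\lambda\mid\lambda-A\text{ is not injective}\}$; $\sigma_{\mathrm{r}}(A):=\{\lambda\mid\operatorname{ran}(\lambda-A)\text{ is not dense in }X\}$; $\sigma_{\mathrm{ap}}(A)$ is the set of $\lambda$ for which there is a net $(x_i)_{i\in I}\subseteq D(A)$ not converging to $0$ with $\lim_{i\in I}(A-\lambda)x_i=0$; $\sigma_{\mathrm{ap}}^{\mathrm{seq}}(A)$ is defined likewise with sequences instead of nets; $\sigma_{\mathrm{bap}}(A)$ (resp. $\sigma_{\mathrm{bap}}^{\mathrm{seq}}(A)$) is the set of those $\lambda$ for which the net (resp. sequence) can be chosen bounded in $X$. For $M\subseteq\mathbb{C}$, $\mathrm{e}^{tM}:=\{\mathrm{e}^{t\lambda}\mid\lambda\in M\}$. *)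

theory Defs
  imports "HOL-Analysis.Analysis"
begin

section \<open>Complex locally convex spaces\<close>

class complex_vector = ab_group_add +
  fixes scaleC :: "complex \<Rightarrow> 'a \<Rightarrow> 'a"  (infixr \<open>*\<^sub>C\<close> 75)
  assumes scaleC_add_right: "a *\<^sub>C (x + y) = a *\<^sub>C x + a *\<^sub>C y"
    and scaleC_add_left: "(a + b) *\<^sub>C x = a *\<^sub>C x + b *\<^sub>C x"
    and scaleC_scaleC: "a *\<^sub>C b *\<^sub>C x = (a * b) *\<^sub>C x"
    and scaleC_one: "1 *\<^sub>C x = x"

interpretation complex_vector: vector_space "scaleC :: complex \<Rightarrow> 'a \<Rightarrow> 'a::complex_vector"
  by unfold_locales
    (rule scaleC_add_right scaleC_add_left scaleC_scaleC scaleC_one)+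

definition seminorm :: "('a::complex_vector \<Rightarrow> real) \<Rightarrow> bool" where
  "seminorm p \<longleftrightarrow>
     (\<forall>x. 0 \<le> p x) \<and>
     (\<forall>x y. p (x + y) \<le> p x + p y) \<and>
     (\<forall>c x. p (c *\<^sub>C x) = cmod c * p x)"

text \<open>The type \<open>'a\<close> is a locally convex space iff some such \<open>\<Gamma>\<close> exists. The second conjunct
  says that the topology of the type is the one induced by \<open>\<Gamma>\<close>, the third that \<open>\<Gamma>\<close> is
  fundamental. The Hausdorff property comes from the class \<open>t2_space\<close>.\<close>

definition fundamental_seminorms :: "('a::{complex_vector,topological_space} \<Rightarrow> real) set \<Rightarrow> bool"
  where "fundamental_seminorms \<Gamma> \<longleftrightarrow>
     (\<forall>p\<in>\<Gamma>. seminorm p) \<and>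
     (\<forall>U. open U \<longleftrightarrow> generate_topology {{y. p (y - x) < e} |p x e. p \<in> \<Gamma> \<and> 0 < e} U) \<and>
     (\<forall>q. seminorm q \<and> continuous_on UNIV q \<longrightarrow> (\<exists>p\<in>\<Gamma>. \<exists>C\<ge>0. \<forall>x. q x \<le> C * p x))"

definition Cauchy_sequence :: "(nat \<Rightarrow> 'a::{ab_group_add,topological_space}) \<Rightarrow> bool" where
  "Cauchy_sequence u \<longleftrightarrow>
     (\<forall>U. open U \<and> 0 \<in> U \<longrightarrow> (\<exists>N. \<forall>m\<ge>N. \<forall>n\<ge>N. u m - u n \<in> U))"

definition sequentially_complete :: "'a::{ab_group_add,topological_space} itself \<Rightarrow> bool" where
  "sequentially_complete _ \<longleftrightarrow>
     (\<forall>u :: nat \<Rightarrow> 'a. Cauchy_sequence u \<longrightarrow> (\<exists>l. u \<longlonglongrightarrow> l))"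

definition lcs_bounded :: "('a \<Rightarrow> real) set \<Rightarrow> 'a set \<Rightarrow> bool" where
  "lcs_bounded \<Gamma> B \<longleftrightarrow> (\<forall>p\<in>\<Gamma>. bdd_above (p ` B))"

definition continuous_operators :: "('a::{complex_vector,topological_space} \<Rightarrow> 'a) set" where
  "continuous_operators =
     {S. Vector_Spaces.linear scaleC scaleC S \<and> continuous_on UNIV S}"

definition equicontinuous :: "('a \<Rightarrow> real) set \<Rightarrow> ('a \<Rightarrow> 'a) set \<Rightarrow> bool" where
  "equicontinuous \<Gamma> \<S> \<longleftrightarrow>
     (\<forall>q\<in>\<Gamma>. \<exists>p\<in>\<Gamma>. \<exists>C\<ge>0. \<forall>S\<in>\<S>. \<forall>x. q (S x) \<le> C * p x)"


section \<open>Semigroups\<close>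

text \<open>A family \<open>(T(t))\<close> indexed by \<open>t \<ge> 0\<close> is a function on \<open>real\<close> of which only the values at
  nonnegative arguments are used.\<close>

definition operator_semigroup :: "(real \<Rightarrow> 'a::{complex_vector,topological_space} \<Rightarrow> 'a) \<Rightarrow> bool"
  where "operator_semigroup T \<longleftrightarrow>
     (\<forall>t\<ge>0. T t \<in> continuous_operators) \<and>
     T 0 = id \<and>
     (\<forall>t\<ge>0. \<forall>s\<ge>0. T (t + s) = T t \<circ> T s)"

definition strongly_continuous :: "(real \<Rightarrow> 'a::topological_space \<Rightarrow> 'a) \<Rightarrow> bool" where
  "strongly_continuous T \<longleftrightarrow> (\<forall>x. continuous_on {0..} (\<lambda>t. T t x))"

definition locally_equicontinuous :: "('a \<Rightarrow> real) set \<Rightarrow> (real \<Rightarrow> 'a \<Rightarrow> 'a) \<Rightarrow> bool" where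
  "locally_equicontinuous \<Gamma> T \<longleftrightarrow>
     (\<forall>q\<in>\<Gamma>. \<forall>t0\<ge>0. \<exists>p\<in>\<Gamma>. \<exists>C\<ge>0. \<forall>t\<in>{0..t0}. \<forall>x. q (T t x) \<le> C * p x)"

definition difference_quotient ::
    "(real \<Rightarrow> 'a::complex_vector \<Rightarrow> 'a) \<Rightarrow> 'a \<Rightarrow> real \<Rightarrow> 'a" where
  "difference_quotient T x t = complex_of_real (1 / t) *\<^sub>C (T t x - x)"

definition generator_domain :: "(real \<Rightarrow> 'a::{complex_vector,t2_space} \<Rightarrow> 'a) \<Rightarrow> 'a set" where
  "generator_domain T = {x. \<exists>y. (difference_quotient T x \<longlongrightarrow> y) (at_right 0)}"

definition generator :: "(real \<Rightarrow> 'a::{complex_vector,t2_space} \<Rightarrow> 'a) \<Rightarrow> 'a \<Rightarrow> 'a" where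
  "generator T x = Lim (at_right 0) (difference_quotient T x)"


section \<open>Spectra\<close>

text \<open>An operator \<open>(A, D(A))\<close> is a pair of a set \<open>D\<close> and a total function \<open>A\<close> of which only the
  values on \<open>D\<close> matter; an everywhere defined operator has \<open>D = UNIV\<close>.\<close>

definition shifted :: "('a::complex_vector \<Rightarrow> 'a) \<Rightarrow> complex \<Rightarrow> 'a \<Rightarrow> 'a" where
  "shifted A l x = l *\<^sub>C x - A x"

definition alg_spectrum :: "'a::complex_vector set \<Rightarrow> ('a \<Rightarrow> 'a) \<Rightarrow> complex set" where
  "alg_spectrum D A = {l. \<not> bij_betw (shifted A l) D UNIV}"

definition resolvent :: "'a::complex_vector set \<Rightarrow> ('a \<Rightarrow> 'a) \<Rightarrow> complex \<Rightarrow> 'a \<Rightarrow> 'a" where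
  "resolvent D A l = inv_into D (shifted A l)"

definition resolvent_set ::
    "'a::{complex_vector,topological_space} set \<Rightarrow> ('a \<Rightarrow> 'a) \<Rightarrow> complex set" where
  "resolvent_set D A =
     {l. bij_betw (shifted A l) D UNIV \<and> resolvent D A l \<in> continuous_operators}"

definition spectrum ::
    "'a::{complex_vector,topological_space} set \<Rightarrow> ('a \<Rightarrow> 'a) \<Rightarrow> complex set" where
  "spectrum D A = - resolvent_set D A"

definition star_resolvent_set ::
    "('a::{complex_vector,topological_space} \<Rightarrow> real) set \<Rightarrow> 'a set \<Rightarrow> ('a \<Rightarrow> 'a) \<Rightarrow> complex set" where
  "star_resolvent_set \<Gamma> D A =
     {l \<in> resolvent_set D A.
        \<exists>d>0. ball l d \<subseteq> resolvent_set D A \<and> equicontinuous \<Gamma> (resolvent D A ` ball l d)}"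

definition star_spectrum ::
    "('a::{complex_vector,topological_space} \<Rightarrow> real) set \<Rightarrow> 'a set \<Rightarrow> ('a \<Rightarrow> 'a) \<Rightarrow> complex set" where
  "star_spectrum \<Gamma> D A = - star_resolvent_set \<Gamma> D A"

definition point_spectrum :: "'a::complex_vector set \<Rightarrow> ('a \<Rightarrow> 'a) \<Rightarrow> complex set" where
  "point_spectrum D A = {l. \<not> inj_on (shifted A l) D}"

definition residual_spectrum ::
    "'a::{complex_vector,topological_space} set \<Rightarrow> ('a \<Rightarrow> 'a) \<Rightarrow> complex set" where
  "residual_spectrum D A = {l. closure (shifted A l ` D) \<noteq> UNIV}"


subsection \<open>Approximate point spectra\<close>

definition directed_preorder :: "'i set \<Rightarrow> 'i rel \<Rightarrow> bool" where
  "directed_preorder I r \<longleftrightarrow>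
     I \<noteq> {} \<and> preorder_on I r \<and> (\<forall>i\<in>I. \<forall>j\<in>I. \<exists>k\<in>I. (i, k) \<in> r \<and> (j, k) \<in> r)"

text \<open>The filter of tails of a directed set: limits of a net indexed by \<open>(I, r)\<close> are limits along
  this filter, see \<open>tendsto_net_filter\<close> below.\<close>

definition net_filter :: "'i set \<Rightarrow> 'i rel \<Rightarrow> 'i filter" where
  "net_filter I r = (INF i\<in>I. principal {j. (i, j) \<in> r})"

definition approx_eigen :: "'i filter \<Rightarrow> ('i \<Rightarrow> 'a::{complex_vector,topological_space}) \<Rightarrow>
    ('a \<Rightarrow> 'a) \<Rightarrow> complex \<Rightarrow> bool" where
  "approx_eigen F x A l \<longleftrightarrow>
     \<not> (x \<longlongrightarrow> 0) F \<and> ((\<lambda>i. A (x i) - l *\<^sub>C x i) \<longlongrightarrow> 0) F"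

text \<open>HOL cannot quantify over the index type of a net inside a definition. The index sets range over
  the directed subsets of the fixed type \<open>'a set \<times> 'a\<close>, and this is no restriction:
  \<open>ap_spectrumI\<close> and \<open>bap_spectrumI\<close> below show that nets over an arbitrary index type
  give no further points.\<close>

definition ap_spectrum ::
    "'a::{complex_vector,topological_space} set \<Rightarrow> ('a \<Rightarrow> 'a) \<Rightarrow> complex set" where
  "ap_spectrum D A =
     {l. \<exists>(I :: ('a set \<times> 'a) set) r x.
        directed_preorder I r \<and> x ` I \<subseteq> D \<and> approx_eigen (net_filter I r) x A l}"

definition bap_spectrum ::
    "('a::{complex_vector,topological_space} \<Rightarrow> real) set \<Rightarrow> 'a set \<Rightarrow> ('a \<Rightarrow> 'a) \<Rightarrow> complex set" where
  "bap_spectrum \<Gamma> D A =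
     {l. \<exists>(I :: ('a set \<times> 'a) set) r x.
        directed_preorder I r \<and> x ` I \<subseteq> D \<and> lcs_bounded \<Gamma> (x ` I) \<and>
        approx_eigen (net_filter I r) x A l}"

definition ap_spectrum_seq ::
    "'a::{complex_vector,topological_space} set \<Rightarrow> ('a \<Rightarrow> 'a) \<Rightarrow> complex set" where
  "ap_spectrum_seq D A =
     {l. \<exists>x :: nat \<Rightarrow> 'a. range x \<subseteq> D \<and> approx_eigen sequentially x A l}"

definition bap_spectrum_seq ::
    "('a::{complex_vector,topological_space} \<Rightarrow> real) set \<Rightarrow> 'a set \<Rightarrow> ('a \<Rightarrow> 'a) \<Rightarrow> complex set" where
  "bap_spectrum_seq \<Gamma> D A =
     {l. \<exists>x :: nat \<Rightarrow> 'a. range x \<subseteq> D \<and> lcs_bounded \<Gamma> (range x) \<and>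
        approx_eigen sequentially x A l}"

lemma eventually_net_filter:
  assumes "directed_preorder I r"
  shows "eventually P (net_filter I r) \<longleftrightarrow> (\<exists>i\<in>I. \<forall>j\<in>I. (i, j) \<in> r \<longrightarrow> P j)"
proof -
  have sub: "r \<subseteq> I \<times> I" and tr: "trans r"
    and dir: "\<And>i j. i \<in> I \<Longrightarrow> j \<in> I \<Longrightarrow> \<exists>k\<in>I. (i, k) \<in> r \<and> (j, k) \<in> r"
    using assms by (auto simp: directed_preorder_def preorder_on_def)
  have "eventually P (net_filter I r) \<longleftrightarrow> (\<exists>i\<in>I. eventually P (principal {j. (i, j) \<in> r}))"
    unfolding net_filter_def
  proof (rule eventually_INF_base)
    show "I \<noteq> {}" using assms by (simp add: directed_preorder_def)
  next
    fix i j assume "i \<in> I" "j \<in> I"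
    then obtain k where "k \<in> I" "(i, k) \<in> r" "(j, k) \<in> r" using dir by blast
    then show "\<exists>k\<in>I. principal {l. (k, l) \<in> r}
        \<le> inf (principal {l. (i, l) \<in> r}) (principal {l. (j, l) \<in> r})"
      using tr by (auto simp: trans_def)
  qed
  also have "\<dots> \<longleftrightarrow> (\<exists>i\<in>I. \<forall>j\<in>I. (i, j) \<in> r \<longrightarrow> P j)"
    using sub by (auto simp: eventually_principal)
  finally show ?thesis .
qed

lemma tendsto_net_filter:
  assumes "directed_preorder I r"
  shows "(x \<longlongrightarrow> l) (net_filter I r) \<longleftrightarrow>
    (\<forall>U. open U \<longrightarrow> l \<in> U \<longrightarrow> (\<exists>i\<in>I. \<forall>j\<in>I. (i, j) \<in> r \<longrightarrow> x j \<in> U))"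
  by (simp add: tendsto_def eventually_net_filter[OF assms])

lemma net_reindex:
  fixes x :: "'i \<Rightarrow> 'a" and r :: "'i rel"
  assumes dir: "directed_preorder I r"
  obtains J :: "('a set \<times> 'a) set" and s where
    "directed_preorder J s" "snd ` J = x ` I" "filtermap snd (net_filter J s) = filtermap x (net_filter I r)"
proof -
  define t where "t i = x ` {j. (i, j) \<in> r}" for i
  define J where "J = {(S, y). \<exists>i\<in>I. S = t i \<and> y \<in> S}"
  define s where "s = {(a, b). a \<in> J \<and> b \<in> J \<and> fst b \<subseteq> fst a}"
  have sub: "r \<subseteq> I \<times> I" and tr: "trans r" and ne: "I \<noteq> {}"
    and rf: "\<And>i. i \<in> I \<Longrightarrow> (i, i) \<in> r"
    and d: "\<And>i j. i \<in> I \<Longrightarrow> j \<in> I \<Longrightarrow> \<exists>k\<in>I. (i, k) \<in> r \<and> (j, k) \<in> r"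
    using dir by (auto simp: directed_preorder_def preorder_on_def refl_on_def)
  have tmono: "t j \<subseteq> t i" if "(i, j) \<in> r" for i j
    using that tr unfolding t_def trans_def by blast
  have tx: "x i \<in> t i" if "i \<in> I" for i
    using rf[OF that] unfolding t_def by blast
  have J_I: "(t i, x j) \<in> J" if "(i, j) \<in> r" for i j
    using that sub unfolding J_def t_def by blast
  have dirJ: "directed_preorder J s"
    unfolding directed_preorder_def
  proof (intro conjI ballI)
    show "J \<noteq> {}" using ne J_I rf by blast
    show "preorder_on J s"
      by (auto simp: preorder_on_def s_def refl_on_def trans_def)
    fix a b assume "a \<in> J" "b \<in> J"
    then obtain i j where "i \<in> I" "j \<in> I" "fst a = t i" "fst b = t j"
      by (auto simp: J_def)
    moreover from this obtain k where "k \<in> I" "(i, k) \<in> r" "(j, k) \<in> r" using d by blast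
    ultimately show "\<exists>c\<in>J. (a, c) \<in> s \<and> (b, c) \<in> s"
      using tmono J_I[OF rf[OF \<open>k \<in> I\<close>]] \<open>a \<in> J\<close> \<open>b \<in> J\<close>
      by (intro bexI[of _ "(t k, x k)"]) (auto simp: s_def)
  qed
  moreover have "snd ` J = x ` I"
  proof
    show "snd ` J \<subseteq> x ` I" using sub by (auto simp: J_def t_def)
    show "x ` I \<subseteq> snd ` J" using J_I[OF rf] by force
  qed
  moreover have "filtermap snd (net_filter J s) = filtermap x (net_filter I r)"
  proof (rule filter_eq_iff[THEN iffD2], intro allI)
    fix P :: "'a \<Rightarrow> bool"
    have "(\<exists>a\<in>J. \<forall>b\<in>J. (a, b) \<in> s \<longrightarrow> P (snd b)) \<longleftrightarrow> (\<exists>i\<in>I. \<forall>j\<in>I. (i, j) \<in> r \<longrightarrow> P (x j))"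
    proof
      assume "\<exists>a\<in>J. \<forall>b\<in>J. (a, b) \<in> s \<longrightarrow> P (snd b)"
      then obtain a where a: "a \<in> J" "\<And>b. b \<in> J \<Longrightarrow> (a, b) \<in> s \<Longrightarrow> P (snd b)" by blast
      then obtain i where i: "i \<in> I" "fst a = t i" by (auto simp: J_def)
      have "P (x j)" if "(i, j) \<in> r" for j
        using a(2)[OF J_I[OF that]] a(1) J_I[OF that] i by (auto simp: s_def)
      then show "\<exists>i\<in>I. \<forall>j\<in>I. (i, j) \<in> r \<longrightarrow> P (x j)" using i by blast
    next
      assume "\<exists>i\<in>I. \<forall>j\<in>I. (i, j) \<in> r \<longrightarrow> P (x j)"
      then obtain i where i: "i \<in> I" "\<And>j. (i, j) \<in> r \<Longrightarrow> P (x j)" using sub by blast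
      have "P (snd b)" if "b \<in> J" "((t i, x i), b) \<in> s" for b
      proof -
        have "snd b \<in> t i" using that by (auto simp: J_def s_def)
        then show ?thesis using i(2) by (auto simp: t_def)
      qed
      then show "\<exists>a\<in>J. \<forall>b\<in>J. (a, b) \<in> s \<longrightarrow> P (snd b)" using J_I[OF rf[OF i(1)]] by blast
    qed
    then show "eventually P (filtermap snd (net_filter J s)) =
        eventually P (filtermap x (net_filter I r))"
      by (simp add: eventually_filtermap eventually_net_filter[OF dirJ] eventually_net_filter[OF dir])
  qed
  ultimately show ?thesis using that by blast
qed

lemma approx_eigen_filtermap:
  "approx_eigen F x A l \<longleftrightarrow> approx_eigen (filtermap x F) (\<lambda>y. y) A l"
  by (simp add: approx_eigen_def filterlim_filtermap)

lemma ap_spectrumI: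
  fixes x :: "'i \<Rightarrow> 'a::{complex_vector,topological_space}" and r :: "'i rel"
  assumes "directed_preorder I r" "x ` I \<subseteq> D" "approx_eigen (net_filter I r) x A l"
  shows "l \<in> ap_spectrum D A"
proof -
  obtain J :: "('a set \<times> 'a) set" and s where J: "directed_preorder J s" "snd ` J = x ` I"
    "filtermap snd (net_filter J s) = filtermap x (net_filter I r)"
    by (rule net_reindex[OF assms(1), where x = x])
  have "approx_eigen (net_filter J s) snd A l"
    using assms(3) J(3) approx_eigen_filtermap[of "net_filter I r" x A l]
      approx_eigen_filtermap[of "net_filter J s" snd A l] by metis
  with J assms show ?thesis
    unfolding ap_spectrum_def mem_Collect_eq by metis
qed

lemma bap_spectrumI:
  fixes x :: "'i \<Rightarrow> 'a::{complex_vector,topological_space}" and r :: "'i rel"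
  assumes "directed_preorder I r" "x ` I \<subseteq> D" "lcs_bounded \<Gamma> (x ` I)"
    "approx_eigen (net_filter I r) x A l"
  shows "l \<in> bap_spectrum \<Gamma> D A"
proof -
  obtain J :: "('a set \<times> 'a) set" and s where J: "directed_preorder J s" "snd ` J = x ` I"
    "filtermap snd (net_filter J s) = filtermap x (net_filter I r)"
    by (rule net_reindex[OF assms(1), where x = x])
  have "approx_eigen (net_filter J s) snd A l"
    using assms(4) J(3) approx_eigen_filtermap[of "net_filter I r" x A l]
      approx_eigen_filtermap[of "net_filter J s" snd A l] by metis
  with J assms show ?thesis
    unfolding bap_spectrum_def mem_Collect_eq by metis
qed

definition exp_image :: "real \<Rightarrow> complex set \<Rightarrow> complex set" where
  "exp_image t M = {exp (complex_of_real t * l) |l. l \<in> M}"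

end

theory Submission
  imports Defs
begin

text \<open>
  Write \<open>A\<close> for the generator and \<open>D\<close> for its domain. Everything rests on the operator
  \<open>J x = \<integral>\<^sub>0\<^sup>t e\<^bsup>l(t-s)\<^esup> T(s)x ds\<close>, which satisfies
  \<open>(l - A) J x = e\<^bsup>tl\<^esup> x - T(t)x\<close> for all \<open>x\<close>, and
  \<open>J (l - A) x = e\<^bsup>tl\<^esup> x - T(t)x\<close> for \<open>x\<close> in \<open>D\<close>
  (lemmas \<open>shifted_generator_quotient_operator\<close> and \<open>quotient_operator_shifted_generator\<close>).
  So \<open>l - A\<close> is a left and a right factor of \<open>e\<^bsup>tl\<^esup> - T(t)\<close>: injectivity, surjectivity and dense
  range of the latter pass to \<open>l - A\<close>. If \<open>T\<close> is locally equicontinuous, then \<open>J\<close> is continuous. It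
  therefore maps the null family \<open>(A - l) x\<^sub>i\<close> of an approximate eigenvector to the null family
  \<open>(T(t) - e\<^bsup>tl\<^esup>) x\<^sub>i\<close>, and \<open>R(l, A) = J R(e\<^bsup>tl\<^esup>, T(t))\<close> is continuous, with seminorm bounds that
  are locally uniform in \<open>l\<close> whenever those of \<open>R(\<mu>, T(t))\<close> are locally uniform in \<open>\<mu>\<close>.

  The integral of a continuous function \<open>f\<close> on \<open>[0, \<infinity>)\<close> is treated as its antiderivative, the
  continuous function that vanishes at \<open>0\<close> and has right derivative \<open>f\<close>. A mean value inequality
  for right derivatives, applied to each seminorm, makes it unique (\<open>antiderivative_unique\<close>), bounds
  it, and shows that Riemann sums are Cauchy sequences, whose limits exist by sequential
  completeness (\<open>antiderivative_exists\<close>). Uniqueness then proves identities between integrals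
  by comparison of derivatives. Replacing \<open>T(s)\<close> by \<open>e\<^bsup>-sl\<^esup> T(s)\<close> reduces both identities for \<open>J\<close> to
  \<open>l = 0\<close>, where they are \<open>difference_quotient_orbit_integral\<close> and \<open>orbit_integral_generator\<close>.
\<close>

section \<open>Limits, continuity and operators described by seminorms\<close>

locale locally_convex =
  fixes \<Gamma> :: "('a::{complex_vector,t2_space} \<Rightarrow> real) set"
  assumes fundamental: "fundamental_seminorms \<Gamma>"
begin

lemma seminorm_mem: "p \<in> \<Gamma> \<Longrightarrow> seminorm p"
  using fundamental by (simp add: fundamental_seminorms_def)

lemma nonneg: "p \<in> \<Gamma> \<Longrightarrow> 0 \<le> p x"
  and triangle: "p \<in> \<Gamma> \<Longrightarrow> p (x + y) \<le> p x + p y"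
  and scale: "p \<in> \<Gamma> \<Longrightarrow> p (c *\<^sub>C x) = cmod c * p x"
  using seminorm_mem by (auto simp: seminorm_def)

lemma at_zero: "p \<in> \<Gamma> \<Longrightarrow> p 0 = 0"
  using scale[of p 0 0] by simp

lemma at_minus: "p \<in> \<Gamma> \<Longrightarrow> p (- x) = p x"
  using scale[of p "-1" x] by (simp add: complex_vector.scale_minus_left)

lemma minus_commute: "p \<in> \<Gamma> \<Longrightarrow> p (x - y) = p (y - x)"
  using at_minus[of p "x - y"] by simp

lemma triangle_minus: "p \<in> \<Gamma> \<Longrightarrow> p (x - y) \<le> p x + p y"
  using triangle[of p x "- y"] by (simp add: at_minus)

lemma triangle_via: "p \<in> \<Gamma> \<Longrightarrow> p (x - z) \<le> p (x - y) + p (y - z)"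
  using triangle[of p "x - y" "y - z"] by simp

lemma reverse_triangle: "p \<in> \<Gamma> \<Longrightarrow> \<bar>p x - p y\<bar> \<le> p (x - y)"
  using triangle[of p "x - y" y] triangle[of p "y - x" x] minus_commute[of p x y] by simp

lemma sum_le: "p \<in> \<Gamma> \<Longrightarrow> p (\<Sum>i\<in>I. f i) \<le> (\<Sum>i\<in>I. p (f i))"
proof (induction I rule: infinite_finite_induct)
  case (insert i I)
  then show ?case using triangle[of p "f i" "sum f I"] by simp
qed (simp_all add: at_zero)

lemma open_seminorm_ball: "p \<in> \<Gamma> \<Longrightarrow> 0 < e \<Longrightarrow> open {y. p (y - x) < e}"
  using fundamental
  by (auto simp: fundamental_seminorms_def intro!: generate_topology.Basis)

text \<open>The seminorm balls are a subbase of the topology, so convergence need only be tested on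
  them; the triangle inequality replaces their centres by the limit.\<close>

lemma tendsto_seminorms_iff:
  "(f \<longlongrightarrow> l) F \<longleftrightarrow> (\<forall>p\<in>\<Gamma>. ((\<lambda>i. p (f i - l)) \<longlongrightarrow> 0) F)"
proof
  assume f: "(f \<longlongrightarrow> l) F"
  show "\<forall>p\<in>\<Gamma>. ((\<lambda>i. p (f i - l)) \<longlongrightarrow> 0) F"
  proof (intro ballI tendstoI)
    fix p and e :: real assume p: "p \<in> \<Gamma>" "0 < e"
    have "eventually (\<lambda>i. f i \<in> {y. p (y - l) < e}) F"
      by (rule topological_tendstoD[OF f open_seminorm_ball[OF p]]) (simp add: at_zero[OF p(1)] p(2))
    then show "eventually (\<lambda>i. dist (p (f i - l)) 0 < e) F"
      by (simp add: nonneg p)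
  qed
next
  assume f: "\<forall>p\<in>\<Gamma>. ((\<lambda>i. p (f i - l)) \<longlongrightarrow> 0) F"
  show "(f \<longlongrightarrow> l) F"
  proof (rule topological_tendstoI)
    fix U :: "'a set" assume "open U" and l: "l \<in> U"
    then have "generate_topology {{y. p (y - x) < e} |p x e. p \<in> \<Gamma> \<and> 0 < e} U"
      using fundamental by (simp add: fundamental_seminorms_def)
    then show "eventually (\<lambda>i. f i \<in> U) F" using l
    proof induction
      case (UN K)
      then obtain k where k: "k \<in> K" "l \<in> k" by blast
      show ?case by (rule eventually_mono[OF UN.IH[OF k]]) (use k in blast)
    next
      case (Basis U)
      then obtain p x e where U: "U = {y. p (y - x) < e}" and p: "p \<in> \<Gamma>" by blast
      have "0 < e - p (l - x)" using Basis(2) U by simp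
      then have "eventually (\<lambda>i. p (f i - l) < e - p (l - x)) F"
        using f p by (blast dest: order_tendstoD(2))
      then show ?case
      proof (rule eventually_mono)
        fix i assume "p (f i - l) < e - p (l - x)"
        then show "f i \<in> U" using triangle_via[OF p, of "f i" x l] by (simp add: U)
      qed
    qed (auto intro: eventually_conj)
  qed
qed

lemma eq_if_seminorms_zero:
  fixes x y :: 'a
  assumes "\<And>p. p \<in> \<Gamma> \<Longrightarrow> p (x - y) = 0"
  shows "x = y"
proof -
  have "((\<lambda>_::nat. x) \<longlongrightarrow> y) sequentially"
    unfolding tendsto_seminorms_iff
  proof
    fix p assume "p \<in> \<Gamma>"
    then have "p (x - y) = 0" by (rule assms)
    then show "(\<lambda>_. p (x - y)) \<longlonglongrightarrow> 0" by simp
  qed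
  then show ?thesis
    using tendsto_unique[OF sequentially_bot tendsto_const] by blast
qed

lemma seminorm_null_comparison:
  assumes "p \<in> \<Gamma>" "\<And>i. p (f i) \<le> g i" "(g \<longlongrightarrow> 0) F"
  shows "((\<lambda>i. p (f i)) \<longlongrightarrow> 0) F"
  by (rule tendsto_sandwich[OF always_eventually always_eventually tendsto_const assms(3)])
    (simp_all add: assms nonneg)

lemma tendsto_add_lc:
  fixes f g :: "'i \<Rightarrow> 'a"
  assumes "(f \<longlongrightarrow> a) F" "(g \<longlongrightarrow> b) F"
  shows "((\<lambda>i. f i + g i) \<longlongrightarrow> a + b) F"
  unfolding tendsto_seminorms_iff
proof
  fix p assume p: "p \<in> \<Gamma>"
  have "((\<lambda>i. p (f i - a) + p (g i - b)) \<longlongrightarrow> 0 + 0) F"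
    using assms p unfolding tendsto_seminorms_iff by (intro tendsto_add) blast+
  moreover have "p (f i + g i - (a + b)) \<le> p (f i - a) + p (g i - b)" for i
    using triangle[OF p, of "f i - a" "g i - b"] by (simp add: add_diff_add)
  ultimately show "((\<lambda>i. p (f i + g i - (a + b))) \<longlongrightarrow> 0) F"
    by (intro seminorm_null_comparison[OF p]) simp_all
qed

lemma tendsto_scale_lc:
  fixes f :: "'i \<Rightarrow> 'a"
  assumes c: "(c \<longlongrightarrow> k) F" and f: "(f \<longlongrightarrow> a) F"
  shows "((\<lambda>i. c i *\<^sub>C f i) \<longlongrightarrow> k *\<^sub>C a) F"
  unfolding tendsto_seminorms_iff
proof
  fix p assume p: "p \<in> \<Gamma>"
  let ?g = "\<lambda>i. cmod (c i) * p (f i - a) + cmod (c i - k) * p a"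
  have "((\<lambda>i. cmod (c i - k)) \<longlongrightarrow> 0) F"
    using c by (simp add: LIM_zero tendsto_norm_zero)
  then have g: "(?g \<longlongrightarrow> cmod k * 0 + 0 * p a) F"
    using f p unfolding tendsto_seminorms_iff
    by (intro tendsto_add tendsto_mult tendsto_norm c tendsto_const) blast+
  have "p (c i *\<^sub>C f i - k *\<^sub>C a) \<le> ?g i" for i
  proof -
    have "c i *\<^sub>C f i - k *\<^sub>C a = c i *\<^sub>C (f i - a) + (c i - k) *\<^sub>C a"
      by (simp add: complex_vector.scale_right_diff_distrib complex_vector.scale_left_diff_distrib)
    then have "p (c i *\<^sub>C f i - k *\<^sub>C a) = p (c i *\<^sub>C (f i - a) + (c i - k) *\<^sub>C a)"
      by (rule arg_cong)
    also have "\<dots> \<le> ?g i"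
      using triangle[OF p, of "c i *\<^sub>C (f i - a)" "(c i - k) *\<^sub>C a"] by (simp add: scale[OF p])
    finally show ?thesis .
  qed
  then show "((\<lambda>i. p (c i *\<^sub>C f i - k *\<^sub>C a)) \<longlongrightarrow> 0) F"
    by (rule seminorm_null_comparison[OF p]) (use g in simp)
qed

lemma tendsto_diff_lc:
  fixes f g :: "'i \<Rightarrow> 'a"
  assumes "(f \<longlongrightarrow> a) F" "(g \<longlongrightarrow> b) F"
  shows "((\<lambda>i. f i - g i) \<longlongrightarrow> a - b) F"
  using tendsto_add_lc[OF assms(1) tendsto_scale_lc[OF tendsto_const assms(2), of "-1"]]
  by (simp add: complex_vector.scale_minus_left)

lemma continuous_on_add_lc:
  "continuous_on S f \<Longrightarrow> continuous_on S g \<Longrightarrow> continuous_on S (\<lambda>s. f s + g s)"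
  for f g :: "'i::topological_space \<Rightarrow> 'a"
  by (simp add: continuous_on_def tendsto_add_lc)

lemma continuous_on_diff_lc:
  "continuous_on S f \<Longrightarrow> continuous_on S g \<Longrightarrow> continuous_on S (\<lambda>s. f s - g s)"
  for f g :: "'i::topological_space \<Rightarrow> 'a"
  by (simp add: continuous_on_def tendsto_diff_lc)

lemma continuous_on_scale_lc:
  "continuous_on S c \<Longrightarrow> continuous_on S f \<Longrightarrow> continuous_on S (\<lambda>s. c s *\<^sub>C f s)"
  for f :: "'i::topological_space \<Rightarrow> 'a"
  by (simp add: continuous_on_def tendsto_scale_lc)

lemma continuous_on_sum_lc:
  "(\<And>i. i \<in> I \<Longrightarrow> continuous_on S (f i)) \<Longrightarrow> continuous_on S (\<lambda>s. \<Sum>i\<in>I. f i s)"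
  for f :: "'j \<Rightarrow> 'i::topological_space \<Rightarrow> 'a"
  by (induction I rule: infinite_finite_induct) (simp_all add: continuous_on_add_lc)

lemma tendsto_seminorm:
  assumes p: "p \<in> \<Gamma>" and f: "(f \<longlongrightarrow> a) F"
  shows "((\<lambda>i. p (f i)) \<longlongrightarrow> p a) F"
proof -
  have "((\<lambda>i. p (f i - a)) \<longlongrightarrow> 0) F"
    using f p by (simp add: tendsto_seminorms_iff)
  then show ?thesis
    using reverse_triangle[OF p]
    by (intro Lim_null_comparison[of "\<lambda>i. p (f i) - p a" "\<lambda>i. p (f i - a)", THEN LIM_zero_cancel])
      auto
qed

lemma continuous_on_seminorm:
  "p \<in> \<Gamma> \<Longrightarrow> continuous_on S f \<Longrightarrow> continuous_on S (\<lambda>s. p (f s))"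
  by (simp add: continuous_on_def tendsto_seminorm)

lemma Cauchy_sequenceI:
  fixes u :: "nat \<Rightarrow> 'a"
  assumes "\<And>p e. p \<in> \<Gamma> \<Longrightarrow> 0 < e \<Longrightarrow> \<exists>N. \<forall>m\<ge>N. \<forall>n\<ge>N. p (u m - u n) < e"
  shows "Cauchy_sequence u"
proof -
  have "((\<lambda>(n, m). u m - u n) \<longlongrightarrow> 0) (sequentially \<times>\<^sub>F sequentially)"
    unfolding tendsto_seminorms_iff
    using assms nonneg
    by (auto intro!: tendstoI simp: eventually_prod_sequentially case_prod_beta)
  then show ?thesis
    unfolding Cauchy_sequence_def tendsto_def eventually_prod_sequentially by simp
qed

lemma operator_add: "S \<in> continuous_operators \<Longrightarrow> S (x + y) = S x + S y"
  and operator_scale: "S \<in> continuous_operators \<Longrightarrow> S (c *\<^sub>C x) = c *\<^sub>C S x"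
  for S :: "'a \<Rightarrow> 'a"
  by (auto simp: continuous_operators_def Vector_Spaces.linear_iff)

lemma operator_diff: "S \<in> continuous_operators \<Longrightarrow> S (x - y) = S x - S y" for S :: "'a \<Rightarrow> 'a"
  using operator_add[of S "x - y" y] by simp

lemma operator_tendsto:
  "S \<in> continuous_operators \<Longrightarrow> (f \<longlongrightarrow> a) F \<Longrightarrow> ((\<lambda>i. S (f i)) \<longlongrightarrow> S a) F" for S :: "'a \<Rightarrow> 'a"
  unfolding continuous_operators_def
  by (auto elim: continuous_on_tendsto_compose)

lemma operator_comp:
  fixes S R :: "'a \<Rightarrow> 'a"
  assumes "S \<in> continuous_operators" "R \<in> continuous_operators"
  shows "S \<circ> R \<in> continuous_operators"
  using assms Vector_Spaces.linear_compose continuous_on_compose continuous_on_subset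
  unfolding continuous_operators_def by blast

text \<open>For linear maps a seminorm estimate is a uniform modulus of continuity.\<close>

lemma continuous_operatorI:
  fixes S :: "'a \<Rightarrow> 'a"
  assumes add: "\<And>x y. S (x + y) = S x + S y" and sc: "\<And>c x. S (c *\<^sub>C x) = c *\<^sub>C S x"
    and bound: "\<And>q. q \<in> \<Gamma> \<Longrightarrow> \<exists>p\<in>\<Gamma>. \<exists>C\<ge>0. \<forall>x. q (S x) \<le> C * p x"
  shows "S \<in> continuous_operators"
proof -
  have diff: "S (x - y) = S x - S y" for x y
    using add[of "x - y" y] by simp
  have "(S \<longlongrightarrow> S a) (at a)" for a
    unfolding tendsto_seminorms_iff
  proof
    fix q assume q: "q \<in> \<Gamma>"
    then obtain p C where p: "p \<in> \<Gamma>" "C \<ge> 0" "\<And>x. q (S x) \<le> C * p x" using bound by blast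
    have "((\<lambda>x. p (x - a)) \<longlongrightarrow> 0) (at a)"
      using p(1) tendsto_ident_at[of a UNIV] by (simp add: tendsto_seminorms_iff)
    then have "((\<lambda>x. C * p (x - a)) \<longlongrightarrow> 0) (at a)"
      using tendsto_mult_right_zero by blast
    then show "((\<lambda>x. q (S x - S a)) \<longlongrightarrow> 0) (at a)"
      unfolding diff[symmetric] using p(3) by (intro seminorm_null_comparison[OF q])
  qed
  then have "continuous_on UNIV S" by (simp add: continuous_on_def)
  moreover have "Vector_Spaces.linear scaleC scaleC S"
    using add sc by (simp add: Vector_Spaces.linear_iff complex_vector.vector_space_axioms)
  ultimately show ?thesis by (simp add: continuous_operators_def)
qed

end

section \<open>The mean value inequality for right derivatives\<close>

text \<open>If the conclusion failed, the last point of \<open>[0, t]\<close> at which \<open>\<phi>\<close> does not exceed the line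
  would lie before \<open>t\<close>, and the slope condition there would produce a later one.\<close>

lemma le_line_if_right_slope_le:
  fixes \<phi> :: "real \<Rightarrow> real"
  assumes t: "0 \<le> t" and cont: "continuous_on {0..t} \<phi>"
    and slope: "\<And>r. 0 \<le> r \<Longrightarrow> r < t \<Longrightarrow> eventually (\<lambda>h. \<phi> (r + h) \<le> \<phi> r + M * h) (at_right 0)"
  shows "\<phi> t \<le> \<phi> 0 + M * t"
proof (rule ccontr)
  assume contra: "\<not> ?thesis"
  define K where "K = {u \<in> {0..t}. \<phi> u - M * u \<le> \<phi> 0}"
  have "closed K"
    unfolding K_def by (intro continuous_on_closed_Collect_le continuous_intros cont)
  then have "compact K"
    by (rule compact_Icc[of 0 t, THEN compact_Int_closed, of K, THEN back_subst[of compact]])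
      (auto simp: K_def)
  moreover have "0 \<in> K" using t by (simp add: K_def)
  ultimately obtain c where c: "c \<in> K" and max: "\<And>u. u \<in> K \<Longrightarrow> u \<le> c"
    using compact_attains_sup[of K] by blast
  have "c < t" using c contra by (cases "c = t") (auto simp: K_def)
  have "eventually (\<lambda>h. h < t - c) (at_right 0)"
    using \<open>c < t\<close> by (intro eventually_at_right_less[of "0::real", THEN eventually_mono]
        eventually_at_rightI[of 0 "t - c"]) auto
  moreover have "eventually (\<lambda>h. \<phi> (c + h) \<le> \<phi> c + M * h) (at_right 0)"
    using slope[of c] c \<open>c < t\<close> by (simp add: K_def)
  moreover have "eventually (\<lambda>h::real. 0 < h) (at_right 0)"
    by (rule eventually_at_right_less)
  ultimately have "eventually (\<lambda>h. h < t - c \<and> \<phi> (c + h) \<le> \<phi> c + M * h \<and> 0 < h) (at_right 0)"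
    by eventually_elim simp
  then obtain h where "h < t - c" "\<phi> (c + h) \<le> \<phi> c + M * h" "0 < h"
    using eventually_happens'[OF trivial_limit_at_right_real] by blast
  then have "c + h \<in> K" using c by (auto simp: K_def algebra_simps)
  then show False using max \<open>0 < h\<close> by fastforce
qed

text \<open>Right derivatives suffice because continuous functions are determined by them. They are the
  natural notion here, as the generator is a right derivative at \<open>0\<close>.\<close>

definition antiderivative ::
    "(real \<Rightarrow> 'a::{complex_vector,topological_space}) \<Rightarrow> (real \<Rightarrow> 'a) \<Rightarrow> bool" where
  "antiderivative F f \<longleftrightarrow> F 0 = 0 \<and> continuous_on {0..} F \<and>
     (\<forall>s\<ge>0. ((\<lambda>h. complex_of_real (1 / h) *\<^sub>C (F (s + h) - F s)) \<longlongrightarrow> f s) (at_right 0))"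

context locally_convex
begin

text \<open>Clearing the denominator turns convergence of a right difference quotient into the kind of
  slope condition that the mean value inequality consumes.\<close>

lemma right_quotient_tendsto_iff:
  fixes d :: "real \<Rightarrow> 'a"
  shows "((\<lambda>h. complex_of_real (1 / h) *\<^sub>C d h) \<longlongrightarrow> y) (at_right 0) \<longleftrightarrow>
    (\<forall>p\<in>\<Gamma>. \<forall>e>0. eventually (\<lambda>h. p (d h - complex_of_real h *\<^sub>C y) \<le> e * h) (at_right 0))"
proof -
  have quot: "p (complex_of_real (1 / h) *\<^sub>C d h - y) = p (d h - complex_of_real h *\<^sub>C y) / h"
    if "p \<in> \<Gamma>" "0 < h" for p h
  proof -
    have "complex_of_real (1 / h) *\<^sub>C d h - y
        = complex_of_real (1 / h) *\<^sub>C (d h - complex_of_real h *\<^sub>C y)"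
      using that(2) by (simp add: complex_vector.scale_right_diff_distrib)
    then have "p (complex_of_real (1 / h) *\<^sub>C d h - y)
        = p (complex_of_real (1 / h) *\<^sub>C (d h - complex_of_real h *\<^sub>C y))"
      by (rule arg_cong)
    then show ?thesis
      using that(2) by (simp add: scale[OF that(1)] norm_divide)
  qed
  have "((\<lambda>h. p (complex_of_real (1 / h) *\<^sub>C d h - y)) \<longlongrightarrow> 0) (at_right 0) \<longleftrightarrow>
      (\<forall>e>0. eventually (\<lambda>h. p (d h - complex_of_real h *\<^sub>C y) \<le> e * h) (at_right 0))"
    if p: "p \<in> \<Gamma>" for p
  proof (intro iffI allI impI tendstoI)
    fix e :: real
    assume "((\<lambda>h. p (complex_of_real (1 / h) *\<^sub>C d h - y)) \<longlongrightarrow> 0) (at_right 0)" "0 < e"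
    then have "eventually (\<lambda>h. p (complex_of_real (1 / h) *\<^sub>C d h - y) < e) (at_right 0)"
      by (rule order_tendstoD)
    then show "eventually (\<lambda>h. p (d h - complex_of_real h *\<^sub>C y) \<le> e * h) (at_right 0)"
      using eventually_at_right_less[of "0::real"]
          proof eventually_elim
      case (elim h)
      then show ?case by (simp only: quot[OF p] pos_divide_less_eq less_imp_le)
    qed
  next
    fix e :: real
    assume *: "\<forall>e>0. eventually (\<lambda>h. p (d h - complex_of_real h *\<^sub>C y) \<le> e * h) (at_right 0)"
      and e: "0 < e"
    have "eventually (\<lambda>h. p (d h - complex_of_real h *\<^sub>C y) \<le> e / 2 * h) (at_right 0)"
      using * e half_gt_zero by blast
    then show "eventually (\<lambda>h. dist (p (complex_of_real (1 / h) *\<^sub>C d h - y)) 0 < e) (at_right 0)"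
      using eventually_at_right_less[of "0::real"]
    proof eventually_elim
      case (elim h)
      then have "p (complex_of_real (1 / h) *\<^sub>C d h - y) \<le> e / 2"
        by (simp only: quot[OF p] divide_le_eq) simp
      then show ?case using e nonneg[OF p] by simp
    qed
  qed
  then show ?thesis by (simp add: tendsto_seminorms_iff)
qed

lemma mean_value_inequality:
  fixes F :: "real \<Rightarrow> 'a"
  assumes p: "p \<in> \<Gamma>" and t: "0 \<le> t" and cont: "continuous_on {0..t} F"
    and slope: "\<And>r. 0 \<le> r \<Longrightarrow> r < t \<Longrightarrow> eventually (\<lambda>h. p (F (r + h) - F r) \<le> M * h) (at_right 0)"
  shows "p (F t - F 0) \<le> M * t"
proof -
  have "p (F t - F 0) \<le> p (F 0 - F 0) + M * t"
  proof (rule le_line_if_right_slope_le[OF t])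
    show "continuous_on {0..t} (\<lambda>s. p (F s - F 0))"
      by (intro continuous_on_seminorm p continuous_on_diff_lc cont continuous_on_const)
    fix r :: real assume "0 \<le> r" "r < t"
    from slope[OF this]
    show "eventually (\<lambda>h. p (F (r + h) - F 0) \<le> p (F r - F 0) + M * h) (at_right 0)"
    proof (rule eventually_mono)
      fix h assume "p (F (r + h) - F r) \<le> M * h"
      then show "p (F (r + h) - F 0) \<le> p (F r - F 0) + M * h"
        using triangle_via[OF p, of "F (r + h)" "F 0" "F r"] by simp
    qed
  qed
  then show ?thesis by (simp add: at_zero[OF p])
qed

lemma antiderivative_slope:
  fixes F :: "real \<Rightarrow> 'a"
  assumes F: "antiderivative F f" and p: "p \<in> \<Gamma>" and "0 \<le> r" "0 < e"
  shows "eventually (\<lambda>h. p (F (r + h) - F r - complex_of_real h *\<^sub>C f r) \<le> e * h) (at_right 0)"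
  using assms unfolding antiderivative_def right_quotient_tendsto_iff by blast

lemma antiderivative_bound:
  fixes F :: "real \<Rightarrow> 'a"
  assumes F: "antiderivative F f" and p: "p \<in> \<Gamma>" and t: "0 \<le> t"
    and bound: "\<And>s. 0 \<le> s \<Longrightarrow> s < t \<Longrightarrow> p (f s) \<le> M"
  shows "p (F t) \<le> M * t"
proof (rule field_le_epsilon)
  fix e :: real assume e: "0 < e"
  \<comment> \<open>The slope of \<open>F\<close> is at most \<open>M\<close> only up to an error; \<open>t + 1\<close> avoids dividing by \<open>t = 0\<close>.\<close>
  define e' where "e' = e / (t + 1)"
  have "0 < e'" "e' * t \<le> e" using e t by (auto simp: e'_def field_simps)
  have "p (F t - F 0) \<le> (M + e') * t"
  proof (rule mean_value_inequality[OF p t])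
    show "continuous_on {0..t} F"
      using F by (auto simp: antiderivative_def intro: continuous_on_subset)
    fix r :: real assume r: "0 \<le> r" "r < t"
    show "eventually (\<lambda>h. p (F (r + h) - F r) \<le> (M + e') * h) (at_right 0)"
      using antiderivative_slope[OF F p r(1) \<open>0 < e'\<close>] eventually_at_right_less[of "0::real"]
    proof eventually_elim
      case (elim h)
      have "p (complex_of_real h *\<^sub>C f r) \<le> h * M"
        using bound[OF r] elim(2) by (simp add: scale[OF p] mult_left_mono)
      then show ?case
        using elim(1) triangle[OF p, of "F (r + h) - F r - complex_of_real h *\<^sub>C f r"
            "complex_of_real h *\<^sub>C f r"]
        by (simp add: algebra_simps)
    qed
  qed
  then show "p (F t) \<le> M * t + e"
    using F \<open>e' * t \<le> e\<close> by (simp add: antiderivative_def algebra_simps)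
qed

lemma antiderivative_add:
  fixes F G :: "real \<Rightarrow> 'a"
  assumes "antiderivative F f" "antiderivative G g"
  shows "antiderivative (\<lambda>s. F s + G s) (\<lambda>s. f s + g s)"
  unfolding antiderivative_def
proof (intro conjI allI impI)
  fix s :: real assume "0 \<le> s"
  then have "((\<lambda>h. complex_of_real (1 / h) *\<^sub>C (F (s + h) - F s) +
      complex_of_real (1 / h) *\<^sub>C (G (s + h) - G s)) \<longlongrightarrow> f s + g s) (at_right 0)"
    using assms by (intro tendsto_add_lc) (simp_all add: antiderivative_def)
  then show "((\<lambda>h. complex_of_real (1 / h) *\<^sub>C (F (s + h) + G (s + h) - (F s + G s)))
      \<longlongrightarrow> f s + g s) (at_right 0)"
    by (simp only: scaleC_add_right[symmetric] add_diff_add)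
qed (use assms in \<open>auto simp: antiderivative_def intro: continuous_on_add_lc\<close>)

lemma antiderivative_operator:
  fixes F :: "real \<Rightarrow> 'a"
  assumes F: "antiderivative F f" and S: "S \<in> continuous_operators"
  shows "antiderivative (\<lambda>s. S (F s)) (\<lambda>s. S (f s))"
  unfolding antiderivative_def
proof (intro conjI allI impI)
  show "S (F 0) = 0"
    using F operator_diff[OF S, of 0 0] by (simp add: antiderivative_def)
  show "continuous_on {0..} (\<lambda>s. S (F s))"
    using F S by (auto simp: antiderivative_def continuous_on_def intro: operator_tendsto)
  fix s :: real assume "0 \<le> s"
  then have "((\<lambda>h. S (complex_of_real (1 / h) *\<^sub>C (F (s + h) - F s))) \<longlongrightarrow> S (f s)) (at_right 0)"
    using F by (intro operator_tendsto[OF S]) (simp add: antiderivative_def)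
  then show "((\<lambda>h. complex_of_real (1 / h) *\<^sub>C (S (F (s + h)) - S (F s))) \<longlongrightarrow> S (f s)) (at_right 0)"
    by (simp only: operator_scale[OF S] operator_diff[OF S])
qed

lemma scale_operator: "(\<lambda>x. c *\<^sub>C x) \<in> (continuous_operators :: ('a \<Rightarrow> 'a) set)"
proof (rule continuous_operatorI)
  fix q assume q: "q \<in> \<Gamma>"
  then have "\<forall>x. q (c *\<^sub>C x) \<le> cmod c * q x" by (auto simp only: scale order_refl)
  then show "\<exists>p\<in>\<Gamma>. \<exists>C\<ge>0. \<forall>x. q (c *\<^sub>C x) \<le> C * p x"
    using q norm_ge_zero by blast
next
  show "c *\<^sub>C a *\<^sub>C x = a *\<^sub>C c *\<^sub>C x" for a and x :: 'a
    by (rule complex_vector.scale_left_commute)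
qed (rule scaleC_add_right)

lemma antiderivative_scale:
  fixes F :: "real \<Rightarrow> 'a"
  shows "antiderivative F f \<Longrightarrow> antiderivative (\<lambda>s. c *\<^sub>C F s) (\<lambda>s. c *\<^sub>C f s)"
  by (rule antiderivative_operator[OF _ scale_operator])

lemma antiderivative_diff:
  fixes F G :: "real \<Rightarrow> 'a"
  assumes "antiderivative F f" "antiderivative G g"
  shows "antiderivative (\<lambda>s. F s - G s) (\<lambda>s. f s - g s)"
proof -
  have "antiderivative (\<lambda>s. F s + (- 1) *\<^sub>C G s) (\<lambda>s. f s + (- 1) *\<^sub>C g s)"
    by (rule antiderivative_add[OF assms(1) antiderivative_scale[OF assms(2)]])
  moreover have "a + (- 1) *\<^sub>C b = a - b" for a b :: 'a
    by simp
  ultimately show ?thesis by (simp only:)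
qed

text \<open>The zero bound on the derivative of the difference forces it to vanish. Identities between
  integrals are obtained below from this lemma, by comparing derivatives.\<close>

lemma antiderivative_unique:
  fixes F G :: "real \<Rightarrow> 'a"
  assumes "antiderivative F f" "antiderivative G g" "\<And>s. 0 \<le> s \<Longrightarrow> f s = g s" "0 \<le> t"
  shows "F t = G t"
proof (rule eq_if_seminorms_zero)
  fix p assume p: "p \<in> \<Gamma>"
  have "p (F t - G t) \<le> 0 * t"
    by (rule antiderivative_bound[OF antiderivative_diff[OF assms(1,2)] p assms(4)])
      (simp add: assms(3) at_zero[OF p])
  then show "p (F t - G t) = 0" using nonneg[OF p, of "F t - G t"] by simp
qed

lemma antiderivative_shift:
  fixes F :: "real \<Rightarrow> 'a"
  assumes F: "antiderivative F f" and a: "0 \<le> a"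
  shows "antiderivative (\<lambda>s. F (s + a) - F a) (\<lambda>s. f (s + a))"
  unfolding antiderivative_def
proof (intro conjI allI impI)
  have "continuous_on {0..} (\<lambda>s. F (s + a))"
    using F a by (intro continuous_on_compose2[where f = "\<lambda>s. s + a" and g = F and t = "{0..}"]
        continuous_intros) (auto simp: antiderivative_def)
  then show "continuous_on {0..} (\<lambda>s. F (s + a) - F a)"
    by (intro continuous_on_diff_lc continuous_on_const)
  fix s :: real assume "0 \<le> s"
  then have "((\<lambda>h. complex_of_real (1 / h) *\<^sub>C (F (s + a + h) - F (s + a))) \<longlongrightarrow> f (s + a)) (at_right 0)"
    using F a by (simp add: antiderivative_def)
  then show "((\<lambda>h. complex_of_real (1 / h) *\<^sub>C (F (s + h + a) - F a - (F (s + a) - F a)))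
      \<longlongrightarrow> f (s + a)) (at_right 0)"
    by (simp add: add.commute add.left_commute)
qed simp

end

section \<open>Integration of continuous functions by Riemann sums\<close>

text \<open>The integral over \<open>[0, s]\<close> of the step function that takes the value of \<open>f\<close> at the left end of
  each cell of a mesh of width \<open>1 / (n + 1)\<close>. The first \<open>(n + 1)\<^sup>2\<close> cells exhaust \<open>[0, n + 1]\<close>, so a
  single sequence of meshes serves all of \<open>[0, \<infinity>)\<close>.\<close>

definition step_integral :: "(real \<Rightarrow> 'a::complex_vector) \<Rightarrow> nat \<Rightarrow> real \<Rightarrow> 'a" where
  "step_integral f n s = (\<Sum>k<(n + 1)\<^sup>2.
     complex_of_real (min s (real (Suc k) / real (n + 1)) - min s (real k / real (n + 1)))
       *\<^sub>C f (real k / real (n + 1)))"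

context locally_convex
begin

lemma continuous_on_step_integral: "continuous_on S (step_integral f n)"
  for f :: "real \<Rightarrow> 'a"
proof -
  have "continuous_on S (\<lambda>s. step_integral f n s)"
    unfolding step_integral_def
    by (intro continuous_on_sum_lc continuous_on_scale_lc continuous_on_const continuous_intros)
  then show ?thesis by simp
qed

lemma step_integral_at_zero: "step_integral f n 0 = 0" for f :: "real \<Rightarrow> 'a"
proof -
  have "min 0 (real k / real (n + 1)) = 0" for k by simp
  then show ?thesis unfolding step_integral_def by (simp only: diff_self of_real_0) simp
qed

text \<open>The increment over \<open>[r, s]\<close> is a combination of values of \<open>f\<close> whose weights are the lengths of
  the intersections of the cells with \<open>[r, s]\<close>; these add up to \<open>s - r\<close>, and only the cells that meet
  \<open>[r, s]\<close> count.\<close>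

lemma step_integral_increment:
  fixes f :: "real \<Rightarrow> 'a"
  assumes p: "p \<in> \<Gamma>" and rs: "0 \<le> r" "r \<le> s" "s \<le> real (n + 1)"
    and near: "\<And>a. 0 \<le> a \<Longrightarrow> a \<le> s \<Longrightarrow> r \<le> a + 1 / real (n + 1) \<Longrightarrow> p (f a - f r) \<le> e"
  shows "p (step_integral f n s - step_integral f n r - complex_of_real (s - r) *\<^sub>C f r) \<le> e * (s - r)"
proof -
  define x where "x k = real k / real (n + 1)" for k
  define N where "N = (n + 1)\<^sup>2"
  define w where "w k = (min s (x (Suc k)) - min s (x k)) - (min r (x (Suc k)) - min r (x k))" for k
  have x_step: "x (Suc k) = x k + 1 / real (n + 1)" for k
    by (simp add: x_def add_divide_distrib)
  have x_mono: "x k \<le> x (Suc k)" for k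
    by (simp add: x_step)
  have x0: "x 0 = 0" "0 \<le> x k" for k by (simp_all add: x_def)
  have xN: "x N = real (n + 1)" by (simp only: x_def N_def power2_eq_square of_nat_mult) simp
  have total: "(\<Sum>k<N. min u (x (Suc k)) - min u (x k)) = u" if "0 \<le> u" "u \<le> s" for u
    using that rs(3) xN x0(1) by (simp add: sum_lessThan_telescope[of "\<lambda>k. min u (x k)"])
  have w_sum: "(\<Sum>k<N. w k) = s - r"
    unfolding w_def sum_subtractf[of "\<lambda>k. min s (x (Suc k)) - min s (x k)"]
    using rs by (simp only: total order_trans order_refl)
  have w_nonneg: "0 \<le> w k" for k
    using rs(2) x_mono[of k] by (simp add: w_def min_def)
  have "step_integral f n s - step_integral f n r = (\<Sum>k<N. complex_of_real (w k) *\<^sub>C f (x k))"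
    unfolding step_integral_def x_def[symmetric] N_def[symmetric]
    by (simp only: w_def of_real_diff complex_vector.scale_left_diff_distrib sum_subtractf)
  moreover have "complex_of_real (s - r) *\<^sub>C f r = (\<Sum>k<N. complex_of_real (w k) *\<^sub>C f r)"
    by (simp only: w_sum[symmetric] of_real_sum complex_vector.scale_sum_left)
  ultimately have "step_integral f n s - step_integral f n r - complex_of_real (s - r) *\<^sub>C f r
      = (\<Sum>k<N. complex_of_real (w k) *\<^sub>C (f (x k) - f r))"
    by (simp only: complex_vector.scale_right_diff_distrib sum_subtractf)
  then have "p (step_integral f n s - step_integral f n r - complex_of_real (s - r) *\<^sub>C f r)
      = p (\<Sum>k<N. complex_of_real (w k) *\<^sub>C (f (x k) - f r))"
    by (rule arg_cong)
  also have "\<dots> \<le> (\<Sum>k<N. p (complex_of_real (w k) *\<^sub>C (f (x k) - f r)))"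
    by (rule sum_le[OF p])
  also have "\<dots> \<le> (\<Sum>k<N. w k * e)"
  proof (rule sum_mono)
    fix k
    have "p (complex_of_real (w k) *\<^sub>C (f (x k) - f r)) = w k * p (f (x k) - f r)"
      using w_nonneg by (simp add: scale[OF p])
    also have "\<dots> \<le> w k * e"
    proof (cases "x k \<le> s \<and> r \<le> x (Suc k)")
      case True
      then show ?thesis
        using near[of "x k"] x0(2) x_step w_nonneg by (simp add: mult_left_mono)
    next
      case False
      then have "w k = 0"
        using rs(2) x_mono[of k] by (auto simp: w_def min_def)
      then show ?thesis by simp
    qed
    finally show "p (complex_of_real (w k) *\<^sub>C (f (x k) - f r)) \<le> w k * e" .
  qed
  also have "\<dots> = e * (s - r)"
    by (simp only: sum_distrib_right[symmetric] w_sum) (rule mult.commute)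
  finally show ?thesis .
qed

text \<open>The function \<open>(u, v) \<mapsto> p (f u - f v)\<close> is real valued, so its uniform continuity is the classical
  one; comparing \<open>(u, v)\<close> with \<open>(v, v)\<close> gives that of \<open>f\<close>.\<close>

lemma uniformly_continuous_seminorm:
  fixes f :: "real \<Rightarrow> 'a"
  assumes p: "p \<in> \<Gamma>" and f: "continuous_on {0..t} f" and e: "0 < e"
  obtains \<delta> where "0 < \<delta>"
    "\<And>u v. u \<in> {0..t} \<Longrightarrow> v \<in> {0..t} \<Longrightarrow> \<bar>u - v\<bar> < \<delta> \<Longrightarrow> p (f u - f v) \<le> e"
proof -
  define g where "g z = p (f (fst z) - f (snd z))" for z
  have "continuous_on ({0..t} \<times> {0..t}) g"
    unfolding g_def
    by (intro continuous_on_seminorm[OF p] continuous_on_diff_lc continuous_on_compose2[OF f]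
        continuous_intros) auto
  then have "uniformly_continuous_on ({0..t} \<times> {0..t}) g"
    by (intro compact_uniformly_continuous compact_Times compact_Icc)
  then obtain \<delta> where \<delta>: "0 < \<delta>"
    "\<And>z z'. z \<in> {0..t} \<times> {0..t} \<Longrightarrow> z' \<in> {0..t} \<times> {0..t} \<Longrightarrow> dist z' z < \<delta> \<Longrightarrow> dist (g z') (g z) < e"
    using e unfolding uniformly_continuous_on_def by metis
  have "p (f u - f v) \<le> e" if "u \<in> {0..t}" "v \<in> {0..t}" "\<bar>u - v\<bar> < \<delta>" for u v
    using \<delta>(2)[of "(v, v)" "(u, v)"] that nonneg[OF p]
    by (auto simp: g_def dist_Pair_Pair dist_real_def at_zero[OF p])
  with \<delta>(1) show ?thesis using that by blast
qed

text \<open>On fine meshes the step integrals have \<open>f\<close> as their derivative up to \<open>e\<close>, uniformly.\<close>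

lemma step_integral_approximates:
  fixes f :: "real \<Rightarrow> 'a"
  assumes p: "p \<in> \<Gamma>" and f: "continuous_on {0..} f" and e: "0 < e" and t: "0 \<le> t"
  obtains N \<delta> where "0 < \<delta>"
    "\<And>n r s. N \<le> n \<Longrightarrow> 0 \<le> r \<Longrightarrow> r \<le> s \<Longrightarrow> s \<le> t \<Longrightarrow> s - r < \<delta> \<Longrightarrow>
      p (step_integral f n s - step_integral f n r - complex_of_real (s - r) *\<^sub>C f r) \<le> e * (s - r)"
proof -
  obtain \<delta> where \<delta>: "0 < \<delta>"
    "\<And>u v. u \<in> {0..t} \<Longrightarrow> v \<in> {0..t} \<Longrightarrow> \<bar>u - v\<bar> < \<delta> \<Longrightarrow> p (f u - f v) \<le> e"
    using uniformly_continuous_seminorm[OF p continuous_on_subset[OF f] e, of t] by auto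
  obtain N :: nat where N: "t < real N" "1 / \<delta> < real N"
    using reals_Archimedean2[of "max t (1 / \<delta>)"] by auto
  show ?thesis
  proof (rule that[OF \<delta>(1)])
    fix n r s assume n: "N \<le> n" and rs: "0 \<le> r" "r \<le> s" "s \<le> t" "s - r < \<delta>"
    have mesh: "1 / real (n + 1) < \<delta>"
      using N(2) n \<delta>(1) by (simp add: field_simps) (smt (verit) mult_left_mono of_nat_mono)
    show "p (step_integral f n s - step_integral f n r - complex_of_real (s - r) *\<^sub>C f r) \<le> e * (s - r)"
    proof (rule step_integral_increment[OF p rs(1,2)])
      show "s \<le> real (n + 1)" using N(1) n rs(3) by simp
      fix a :: real assume "0 \<le> a" "a \<le> s" "r \<le> a + 1 / real (n + 1)"
      then show "p (f a - f r) \<le> e" using rs mesh by (intro \<delta>(2)) auto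
    qed
  qed
qed

text \<open>By the mean value inequality, two step integrals that both have \<open>f\<close> as approximate derivative
  are close to each other.\<close>

lemma Cauchy_step_integral:
  fixes f :: "real \<Rightarrow> 'a"
  assumes f: "continuous_on {0..} f" and t: "0 \<le> t"
  shows "Cauchy_sequence (\<lambda>n. step_integral f n t)"
proof (rule Cauchy_sequenceI)
  fix p and e :: real assume p: "p \<in> \<Gamma>" and e: "0 < e"
  define e' where "e' = e / (2 * (t + 1))"
  have e': "0 < e'" "2 * e' * t < e" using e t by (auto simp: e'_def field_simps)
  obtain N \<delta> where \<delta>: "0 < \<delta>"
    and approx: "\<And>n r s. N \<le> n \<Longrightarrow> 0 \<le> r \<Longrightarrow> r \<le> s \<Longrightarrow> s \<le> t \<Longrightarrow> s - r < \<delta> \<Longrightarrow>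
      p (step_integral f n s - step_integral f n r - complex_of_real (s - r) *\<^sub>C f r) \<le> e' * (s - r)"
    using step_integral_approximates[OF p f e'(1) t] by metis
  have "p (step_integral f m t - step_integral f n t) < e" if mn: "N \<le> m" "N \<le> n" for m n
  proof -
    define D where "D s = step_integral f m s - step_integral f n s" for s
    have "p (D t - D 0) \<le> (2 * e') * t"
    proof (rule mean_value_inequality[OF p t])
      show "continuous_on {0..t} D"
        unfolding D_def by (intro continuous_on_diff_lc continuous_on_step_integral)
      fix r assume r: "0 \<le> r" "r < t"
      have "p (D (r + h) - D r) \<le> 2 * e' * h" if h: "0 < h" "h < min \<delta> (t - r)" for h
      proof -
        let ?d = "\<lambda>n. step_integral f n (r + h) - step_integral f n r - complex_of_real h *\<^sub>C f r"
        have approx_h: "p (?d k) \<le> e' * h" if "N \<le> k" for k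
          using approx[OF that r(1), of "r + h"] h by simp
        then have "p (?d m) + p (?d n) \<le> 2 * e' * h"
          using add_mono[OF approx_h[OF mn(1)] approx_h[OF mn(2)]] by simp
        moreover have "D (r + h) - D r = ?d m - ?d n" by (simp add: D_def algebra_simps)
        ultimately show ?thesis using triangle_minus[OF p, of "?d m" "?d n"] by simp
      qed
      then show "eventually (\<lambda>h. p (D (r + h) - D r) \<le> 2 * e' * h) (at_right 0)"
        using \<delta> r by (intro eventually_at_rightI[of 0 "min \<delta> (t - r)"]) auto
    qed
    then show ?thesis using e'(2) by (simp add: D_def step_integral_at_zero)
  qed
  then show "\<exists>N. \<forall>m\<ge>N. \<forall>n\<ge>N. p (step_integral f m t - step_integral f n t) < e" by blast
qed

text \<open>The increment estimate for step integrals passes to their limit \<open>F\<close>. Near a point it gives the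
  right derivative of \<open>F\<close>, and, since \<open>p \<circ> f\<close> is bounded on compact intervals, also two-sided
  continuity.\<close>

lemma antiderivative_exists:
  fixes f :: "real \<Rightarrow> 'a"
  assumes complete: "sequentially_complete TYPE('a)" and f: "continuous_on {0..} f"
  shows "\<exists>F. antiderivative F f"
proof -
  have "\<exists>l. (\<lambda>n. step_integral f n s) \<longlonglongrightarrow> l" if "0 \<le> s" for s
    using complete Cauchy_step_integral[OF f that] by (auto simp: sequentially_complete_def)
  then obtain F where F: "\<And>s. 0 \<le> s \<Longrightarrow> (\<lambda>n. step_integral f n s) \<longlonglongrightarrow> F s" by metis
  have increment: "\<exists>\<delta>>0. \<forall>r s. 0 \<le> r \<longrightarrow> r \<le> s \<longrightarrow> s \<le> t \<longrightarrow> s - r < \<delta> \<longrightarrow>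
      p (F s - F r - complex_of_real (s - r) *\<^sub>C f r) \<le> e * (s - r)"
    if p: "p \<in> \<Gamma>" and e: "0 < e" and t: "0 \<le> t" for p e t
  proof -
    obtain N \<delta> where \<delta>: "0 < \<delta>"
      and approx: "\<And>n r s. N \<le> n \<Longrightarrow> 0 \<le> r \<Longrightarrow> r \<le> s \<Longrightarrow> s \<le> t \<Longrightarrow> s - r < \<delta> \<Longrightarrow>
        p (step_integral f n s - step_integral f n r - complex_of_real (s - r) *\<^sub>C f r) \<le> e * (s - r)"
      using step_integral_approximates[OF p f e t] by metis
    have "p (F s - F r - complex_of_real (s - r) *\<^sub>C f r) \<le> e * (s - r)"
      if rs: "0 \<le> r" "r \<le> s" "s \<le> t" "s - r < \<delta>" for r s
    proof (rule tendsto_upperbound)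
      let ?d = "\<lambda>n. step_integral f n s - step_integral f n r - complex_of_real (s - r) *\<^sub>C f r"
      let ?l = "F s - F r - complex_of_real (s - r) *\<^sub>C f r"
      show "(\<lambda>n. p (?d n)) \<longlonglongrightarrow> p ?l"
        using rs by (intro tendsto_seminorm p tendsto_diff_lc tendsto_const F) auto
      show "eventually (\<lambda>n. p (?d n) \<le> e * (s - r)) sequentially"
        using approx rs by (intro eventually_sequentiallyI[of N]) blast
    qed simp
    with \<delta> show ?thesis by blast
  qed
  have "antiderivative F f"
    unfolding antiderivative_def
  proof (intro conjI allI impI)
    show "F 0 = 0"
      using tendsto_unique[OF sequentially_bot F[of 0]] by (simp add: step_integral_at_zero)
  next
    fix s :: real assume s: "0 \<le> s"
    show "((\<lambda>h. complex_of_real (1 / h) *\<^sub>C (F (s + h) - F s)) \<longlongrightarrow> f s) (at_right 0)"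
      unfolding right_quotient_tendsto_iff
    proof (intro ballI allI impI)
      fix p and e :: real assume "p \<in> \<Gamma>" "0 < e"
      then obtain \<delta> where \<delta>: "0 < \<delta>" "\<And>r u. 0 \<le> r \<Longrightarrow> r \<le> u \<Longrightarrow> u \<le> s + 1 \<Longrightarrow> u - r < \<delta> \<Longrightarrow>
          p (F u - F r - complex_of_real (u - r) *\<^sub>C f r) \<le> e * (u - r)"
        using increment[of p e "s + 1"] s by auto
      have "p (F (s + h) - F s - complex_of_real h *\<^sub>C f s) \<le> e * h"
        if "0 < h" "h < min \<delta> 1" for h
        using \<delta>(2)[of s "s + h"] that s by simp
      then show "eventually (\<lambda>h. p (F (s + h) - F s - complex_of_real h *\<^sub>C f s) \<le> e * h) (at_right 0)"
        using \<delta>(1) by (intro eventually_at_rightI[of 0 "min \<delta> 1"]) auto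
    qed
  next
    show "continuous_on {0..} F"
      unfolding continuous_on_def tendsto_seminorms_iff
    proof (intro ballI)
      fix a :: real and p assume "a \<in> {0..}" and p: "p \<in> \<Gamma>"
      then have a: "0 \<le> a" by simp
      have cont: "continuous_on {0..a + 1} f" using f by (rule continuous_on_subset) auto
      have "bounded ((\<lambda>s. p (f s)) ` {0..a + 1})"
        by (intro compact_imp_bounded compact_continuous_image continuous_on_seminorm p cont compact_Icc)
      then obtain B where B: "\<And>s. s \<in> {0..a + 1} \<Longrightarrow> p (f s) \<le> B"
        unfolding bounded_real using abs_le_D1 by blast
      obtain \<delta> where \<delta>: "0 < \<delta>" "\<And>r u. 0 \<le> r \<Longrightarrow> r \<le> u \<Longrightarrow> u \<le> a + 1 \<Longrightarrow> u - r < \<delta> \<Longrightarrow>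
          p (F u - F r - complex_of_real (u - r) *\<^sub>C f r) \<le> 1 * (u - r)"
        using increment[OF p, of 1 "a + 1"] a by auto
      have ordered: "p (F u - F r) \<le> (B + 1) * (u - r)"
        if "0 \<le> r" "r \<le> u" "u \<le> a + 1" "u - r < \<delta>" for r u
      proof -
        have "p (complex_of_real (u - r) *\<^sub>C f r) = (u - r) * p (f r)"
          using that(2) by (simp add: scale[OF p] del: of_real_diff)
        also have "\<dots> \<le> (u - r) * B"
          using B[of r] that by (intro mult_left_mono) auto
        finally show ?thesis
          using \<delta>(2)[OF that] triangle[OF p, of "F u - F r - complex_of_real (u - r) *\<^sub>C f r"
              "complex_of_real (u - r) *\<^sub>C f r"]
          by (simp add: algebra_simps)
      qed
      have le: "p (F s - F a) \<le> (B + 1) * \<bar>s - a\<bar>" if "0 \<le> s" "\<bar>s - a\<bar> < min \<delta> 1" for s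
        using ordered[of a s] ordered[of s a] that a minus_commute[OF p, of "F s" "F a"]
        by (cases "a \<le> s") auto
      have "eventually (\<lambda>s. s \<in> {0..} \<and> \<bar>s - a\<bar> < min \<delta> 1) (at a within {0..})"
        unfolding eventually_at dist_real_def using \<delta>(1) by (intro exI[of _ "min \<delta> 1"]) auto
      then have "eventually (\<lambda>s. norm (p (F s - F a)) \<le> (B + 1) * \<bar>s - a\<bar>) (at a within {0..})"
        by (rule eventually_mono) (use le nonneg[OF p] in auto)
      moreover have "((\<lambda>s. (B + 1) * \<bar>s - a\<bar>) \<longlongrightarrow> (B + 1) * \<bar>a - a\<bar>) (at a within {0..})"
        by (intro tendsto_intros)
      then have "((\<lambda>s. (B + 1) * \<bar>s - a\<bar>) \<longlongrightarrow> 0) (at a within {0..})" by simp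
      ultimately show "((\<lambda>s. p (F s - F a)) \<longlongrightarrow> 0) (at a within {0..})"
        by (rule Lim_null_comparison)
    qed
  qed
  then show ?thesis by blast
qed

end

section \<open>Strongly continuous semigroups\<close>

text \<open>\<open>orbit_integral T t x\<close> is \<open>\<integral>\<^sub>0\<^sup>t T(s)x ds\<close>.\<close>

definition orbit_integral :: "(real \<Rightarrow> 'a::{complex_vector,topological_space} \<Rightarrow> 'a) \<Rightarrow> real \<Rightarrow> 'a \<Rightarrow> 'a" where
  "orbit_integral T t x = (SOME F. antiderivative F (\<lambda>s. T s x)) t"

locale semigroup_lc = locally_convex \<Gamma>
  for \<Gamma> :: "('a::{complex_vector,t2_space} \<Rightarrow> real) set" +
  fixes T :: "real \<Rightarrow> 'a \<Rightarrow> 'a"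
  assumes complete: "sequentially_complete TYPE('a)"
    and semigroup: "operator_semigroup T"
    and strongly_cont: "strongly_continuous T"
begin

lemma T_operator: "0 \<le> t \<Longrightarrow> T t \<in> continuous_operators"
  and T_zero: "T 0 x = x"
  and T_plus: "0 \<le> t \<Longrightarrow> 0 \<le> s \<Longrightarrow> T (t + s) x = T t (T s x)"
  using semigroup by (simp_all add: operator_semigroup_def)

lemma antiderivative_orbit_integral:
  "antiderivative (\<lambda>t. orbit_integral T t x) (\<lambda>s. T s x)"
proof -
  have "\<exists>F. antiderivative F (\<lambda>s. T s x)"
    using strongly_cont by (intro antiderivative_exists complete) (simp add: strongly_continuous_def)
  then show ?thesis unfolding orbit_integral_def by (rule someI_ex)
qed

lemma orbit_integral_add:
  assumes "0 \<le> t"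
  shows "orbit_integral T t (x + y) = orbit_integral T t x + orbit_integral T t y"
  by (rule antiderivative_unique[OF antiderivative_orbit_integral
        antiderivative_add[OF antiderivative_orbit_integral antiderivative_orbit_integral] _ assms])
    (rule operator_add[OF T_operator])

lemma orbit_integral_scale:
  assumes "0 \<le> t"
  shows "orbit_integral T t (c *\<^sub>C x) = c *\<^sub>C orbit_integral T t x"
  by (rule antiderivative_unique[OF antiderivative_orbit_integral
        antiderivative_scale[OF antiderivative_orbit_integral] _ assms])
    (rule operator_scale[OF T_operator])

text \<open>As functions of \<open>t\<close> both sides have the derivative \<open>T (t + h) x\<close> and vanish at \<open>0\<close>.\<close>

lemma semigroup_orbit_integral:
  assumes "0 \<le> h" "0 \<le> t"
  shows "T h (orbit_integral T t x) = orbit_integral T (t + h) x - orbit_integral T h x"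
  by (rule antiderivative_unique[OF
        antiderivative_operator[OF antiderivative_orbit_integral T_operator[OF assms(1)]]
        antiderivative_shift[OF antiderivative_orbit_integral assms(1)] _ assms(2)])
    (simp add: T_plus[symmetric] assms(1) add.commute)

lemma generator_eqI:
  assumes "(difference_quotient T x \<longlongrightarrow> y) (at_right 0)"
  shows "x \<in> generator_domain T" "generator T x = y"
  using assms tendsto_Lim[OF trivial_limit_at_right_real assms]
  by (auto simp: generator_domain_def generator_def)

lemma tendsto_generator:
  assumes "x \<in> generator_domain T"
  shows "(difference_quotient T x \<longlongrightarrow> generator T x) (at_right 0)"
  using assms generator_eqI by (auto simp: generator_domain_def)

text \<open>Applying \<open>T h - id\<close> to the integral over \<open>[0, t]\<close> leaves the integral over \<open>[t, t + h]\<close> minus that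
  over \<open>[0, h]\<close>, and the averages of these tend to \<open>T t x\<close> and \<open>x\<close>.\<close>

lemma difference_quotient_orbit_integral:
  assumes t: "0 \<le> t"
  shows "(difference_quotient T (orbit_integral T t x) \<longlongrightarrow> T t x - x) (at_right 0)"
proof -
  let ?J = "\<lambda>t. orbit_integral T t x"
  have lim: "((\<lambda>h. complex_of_real (1 / h) *\<^sub>C (?J (s + h) - ?J s)) \<longlongrightarrow> T s x) (at_right 0)"
    if "0 \<le> s" for s
    using antiderivative_orbit_integral that unfolding antiderivative_def by blast
  have "((\<lambda>h. complex_of_real (1 / h) *\<^sub>C (?J (t + h) - ?J t) -
      complex_of_real (1 / h) *\<^sub>C (?J (0 + h) - ?J 0)) \<longlongrightarrow> T t x - T 0 x) (at_right 0)"
    by (intro tendsto_diff_lc lim t order_refl)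
  then have "((\<lambda>h. complex_of_real (1 / h) *\<^sub>C (?J (t + h) - ?J t) -
      complex_of_real (1 / h) *\<^sub>C (?J (0 + h) - ?J 0)) \<longlongrightarrow> T t x - x) (at_right 0)"
    by (simp only: T_zero)
  moreover have "eventually (\<lambda>h. complex_of_real (1 / h) *\<^sub>C (?J (t + h) - ?J t) -
      complex_of_real (1 / h) *\<^sub>C (?J (0 + h) - ?J 0)
      = difference_quotient T (?J t) h) (at_right 0)"
    using eventually_at_right_less[of "0::real"]
  proof eventually_elim
    case (elim h)
    have "?J 0 = 0" using antiderivative_orbit_integral unfolding antiderivative_def by blast
    then have "?J (t + h) - ?J t - (?J (0 + h) - ?J 0) = T h (?J t) - ?J t"
      using semigroup_orbit_integral[of h t x] elim t by simp
    then show ?case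
      by (simp only: difference_quotient_def complex_vector.scale_right_diff_distrib[symmetric])
  qed
  ultimately show ?thesis by (rule Lim_transform_eventually)
qed

text \<open>The orbit of a point of the domain is right differentiable, so it is the antiderivative of its
  derivative. Interchanging the generator with the integral would instead use that the integral
  is continuous in \<open>x\<close>, which comes from local equicontinuity.\<close>

lemma orbit_integral_generator:
  assumes x: "x \<in> generator_domain T" and t: "0 \<le> t"
  shows "orbit_integral T t (generator T x) = T t x - x"
proof -
  have "antiderivative (\<lambda>s. T s x - x) (\<lambda>s. T s (generator T x))"
    unfolding antiderivative_def
  proof (intro conjI allI impI)
    show "T 0 x - x = 0" by (simp add: T_zero)
    show "continuous_on {0..} (\<lambda>s. T s x - x)"
      using strongly_cont
      by (intro continuous_on_diff_lc continuous_on_const) (simp add: strongly_continuous_def)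
    fix s :: real assume s: "0 \<le> s"
    have lim: "((\<lambda>h. T s (difference_quotient T x h)) \<longlongrightarrow> T s (generator T x)) (at_right 0)"
      by (rule operator_tendsto[OF T_operator[OF s] tendsto_generator[OF x]])
    have eq: "eventually (\<lambda>h. T s (difference_quotient T x h)
        = complex_of_real (1 / h) *\<^sub>C (T (s + h) x - x - (T s x - x))) (at_right 0)"
      using eventually_at_right_less[of "0::real"]
    proof eventually_elim
      case (elim h)
      then have "T (s + h) x - x - (T s x - x) = T s (T h x - x)"
        using s by (simp add: T_plus operator_diff[OF T_operator[OF s]])
      then show ?case
        by (simp only: difference_quotient_def operator_scale[OF T_operator[OF s]])
    qed
    show "((\<lambda>h. complex_of_real (1 / h) *\<^sub>C (T (s + h) x - x - (T s x - x)))
        \<longlongrightarrow> T s (generator T x)) (at_right 0)"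
      by (rule Lim_transform_eventually[OF lim eq])
  qed
  from antiderivative_unique[OF antiderivative_orbit_integral this _ t] show ?thesis by simp
qed

end


section \<open>Rescaling by an exponential\<close>

text \<open>Passing from \<open>T(s)\<close> to \<open>e\<^bsup>-sl\<^esup> T(s)\<close> replaces the generator \<open>A\<close> by \<open>A - l\<close> and so reduces
  statements about \<open>l\<close> to the orbit integrals above.\<close>

definition rescale :: "complex \<Rightarrow> (real \<Rightarrow> 'a \<Rightarrow> 'a::complex_vector) \<Rightarrow> real \<Rightarrow> 'a \<Rightarrow> 'a" where
  "rescale l T s x = exp (- (complex_of_real s * l)) *\<^sub>C T s x"

lemma rescale_uminus_rescale: "rescale (- l) (rescale l T) = T"
  by (simp add: rescale_def fun_eq_iff exp_add[symmetric])

lemma exp_right_derivative: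
  "((\<lambda>h. (exp (- (complex_of_real h * l)) - 1) / complex_of_real h) \<longlongrightarrow> - l) (at_right 0)"
proof -
  have "((\<lambda>z. exp (- (z * l))) has_field_derivative - l) (at 0)"
    by (auto intro!: derivative_eq_intros)
  then have "((\<lambda>z. (exp (- (z * l)) - 1) / z) \<longlongrightarrow> - l) (at 0)"
    by (simp add: has_field_derivative_iff)
  moreover have "filterlim complex_of_real (at 0) (at_right 0)"
    unfolding filterlim_at
  proof
    show "eventually (\<lambda>h. complex_of_real h \<in> UNIV \<and> complex_of_real h \<noteq> 0) (at_right 0)"
      using eventually_at_right_less[of "0::real"] by eventually_elim simp
    have "((\<lambda>h. complex_of_real h) \<longlongrightarrow> complex_of_real 0) (at_right 0)"
      by (rule tendsto_of_real[OF tendsto_ident_at])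
    then show "(complex_of_real \<longlongrightarrow> 0) (at_right 0)" by simp
  qed
  ultimately show ?thesis by (rule filterlim_compose)
qed

context semigroup_lc
begin

lemma semigroup_lc_rescale: "semigroup_lc \<Gamma> (rescale l T)"
proof
  show "sequentially_complete TYPE('a)" by (rule complete)
  show "strongly_continuous (rescale l T)"
    using strongly_cont unfolding strongly_continuous_def rescale_def
    by (intro allI continuous_on_scale_lc continuous_intros) blast
  have "rescale l T t \<in> continuous_operators" if "0 \<le> t" for t
    using operator_comp[OF scale_operator T_operator[OF that]]
    unfolding rescale_def[abs_def] comp_def .
  moreover have "rescale l T (t + s) x = rescale l T t (rescale l T s x)"
    if ts: "0 \<le> t" "0 \<le> s" for t s x
    by (simp add: rescale_def T_plus[OF ts] operator_scale[OF T_operator[OF ts(1)]]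
        distrib_right exp_add[symmetric])
  ultimately show "operator_semigroup (rescale l T)"
    by (auto simp: operator_semigroup_def fun_eq_iff rescale_def T_zero)
qed

lemma difference_quotient_rescale:
  assumes x: "x \<in> generator_domain T"
  shows "(difference_quotient (rescale l T) x \<longlongrightarrow> generator T x - l *\<^sub>C x) (at_right 0)"
proof -
  let ?e = "\<lambda>h. exp (- (complex_of_real h * l))"
  have "(?e \<longlongrightarrow> exp (- (complex_of_real 0 * l))) (at_right 0)"
    by (intro tendsto_intros)
  then have "((\<lambda>h. ?e h *\<^sub>C difference_quotient T x h + ((?e h - 1) / complex_of_real h) *\<^sub>C x)
      \<longlongrightarrow> exp (- (complex_of_real 0 * l)) *\<^sub>C generator T x + (- l) *\<^sub>C x) (at_right 0)"
    by (intro tendsto_add_lc tendsto_scale_lc exp_right_derivative tendsto_const tendsto_generator x)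
  moreover have "?e h *\<^sub>C difference_quotient T x h + ((?e h - 1) / complex_of_real h) *\<^sub>C x
      = difference_quotient (rescale l T) x h" for h
    by (simp add: difference_quotient_def rescale_def complex_vector.scale_right_diff_distrib
        complex_vector.scale_left_diff_distrib diff_divide_distrib mult.commute)
  ultimately show ?thesis by simp
qed

text \<open>Rescaling by \<open>- l\<close> undoes rescaling by \<open>l\<close>, so one inclusion of domains yields the other.\<close>

lemma generator_rescale:
  shows generator_domain_rescale: "generator_domain (rescale l T) = generator_domain T"
    and "x \<in> generator_domain T \<Longrightarrow> generator (rescale l T) x = generator T x - l *\<^sub>C x"
proof -
  interpret U: semigroup_lc \<Gamma> "rescale l T" by (rule semigroup_lc_rescale)
  show "x \<in> generator_domain T \<Longrightarrow> generator (rescale l T) x = generator T x - l *\<^sub>C x"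
    by (rule U.generator_eqI(2)[OF difference_quotient_rescale])
  have "y \<in> generator_domain T" if "y \<in> generator_domain (rescale l T)" for y
    using generator_eqI(1)[of y] U.difference_quotient_rescale[OF that, of "- l"]
    by (simp only: rescale_uminus_rescale)
  then show "generator_domain (rescale l T) = generator_domain T"
    using U.generator_eqI(1)[OF difference_quotient_rescale] by blast
qed

text \<open>The operator \<open>x \<mapsto> \<integral>\<^sub>0\<^sup>t e\<^bsup>l(t-s)\<^esup> T(s)x ds\<close>, by which \<open>l - A\<close> divides \<open>e\<^bsup>tl\<^esup> - T(t)\<close>.\<close>

definition quotient_operator :: "complex \<Rightarrow> real \<Rightarrow> 'a \<Rightarrow> 'a" where
  "quotient_operator l t x = orbit_integral (rescale l T) t (exp (complex_of_real t * l) *\<^sub>C x)"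

lemma quotient_operator_add:
  "0 \<le> t \<Longrightarrow> quotient_operator l t (x + y) = quotient_operator l t x + quotient_operator l t y"
  and quotient_operator_scale:
  "0 \<le> t \<Longrightarrow> quotient_operator l t (c *\<^sub>C x) = c *\<^sub>C quotient_operator l t x"
proof -
  interpret U: semigroup_lc \<Gamma> "rescale l T" by (rule semigroup_lc_rescale)
  show "0 \<le> t \<Longrightarrow> quotient_operator l t (x + y) = quotient_operator l t x + quotient_operator l t y"
    by (simp add: quotient_operator_def complex_vector.scale_right_distrib U.orbit_integral_add)
  show "0 \<le> t \<Longrightarrow> quotient_operator l t (c *\<^sub>C x) = c *\<^sub>C quotient_operator l t x"
    by (simp add: quotient_operator_def U.orbit_integral_scale mult.commute)
qed

lemma quotient_operator_shifted_generator:
  assumes x: "x \<in> generator_domain T" and t: "0 \<le> t"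
  shows "quotient_operator l t (shifted (generator T) l x) = shifted (T t) (exp (complex_of_real t * l)) x"
proof -
  interpret U: semigroup_lc \<Gamma> "rescale l T" by (rule semigroup_lc_rescale)
  let ?e = "exp (complex_of_real t * l)"
  have "?e *\<^sub>C shifted (generator T) l x = (- ?e) *\<^sub>C generator (rescale l T) x"
    by (simp add: generator_rescale(2)[OF x] shifted_def complex_vector.scale_right_diff_distrib)
  then have "quotient_operator l t (shifted (generator T) l x)
      = (- ?e) *\<^sub>C orbit_integral (rescale l T) t (generator (rescale l T) x)"
    unfolding quotient_operator_def using U.orbit_integral_scale[OF t] by metis
  also have "\<dots> = (- ?e) *\<^sub>C (rescale l T t x - x)"
    using U.orbit_integral_generator[of x t] x t by (simp add: generator_domain_rescale)
  also have "\<dots> = shifted (T t) ?e x"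
    by (simp add: rescale_def shifted_def complex_vector.scale_right_diff_distrib exp_minus)
  finally show ?thesis .
qed

lemma
  assumes t: "0 \<le> t"
  shows quotient_operator_in_domain: "quotient_operator l t x \<in> generator_domain T"
    and shifted_generator_quotient_operator:
      "shifted (generator T) l (quotient_operator l t x) = shifted (T t) (exp (complex_of_real t * l)) x"
proof -
  interpret U: semigroup_lc \<Gamma> "rescale l T" by (rule semigroup_lc_rescale)
  let ?e = "exp (complex_of_real t * l)"
  note gen = U.generator_eqI[OF U.difference_quotient_orbit_integral[OF t, of "?e *\<^sub>C x"]]
  show dom: "quotient_operator l t x \<in> generator_domain T"
    using gen(1) by (simp only: quotient_operator_def generator_domain_rescale)
  have "rescale l T t (?e *\<^sub>C x) = T t x"
    by (simp add: rescale_def operator_scale[OF T_operator[OF t]] exp_minus)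
  then have "generator T (quotient_operator l t x) - l *\<^sub>C quotient_operator l t x = T t x - ?e *\<^sub>C x"
    using gen(2) generator_rescale(2)[OF dom, of l] by (simp add: quotient_operator_def)
  then show "shifted (generator T) l (quotient_operator l t x) = shifted (T t) ?e x"
    unfolding shifted_def by (metis minus_diff_eq)
qed

end

section \<open>The spectral inclusions\<close>

context semigroup_lc
begin

lemma inj_on_shifted_generator:
  assumes "0 \<le> t" "inj (shifted (T t) (exp (complex_of_real t * l)))"
  shows "inj_on (shifted (generator T) l) (generator_domain T)"
proof (rule inj_onI)
  fix x y assume "x \<in> generator_domain T" "y \<in> generator_domain T"
    "shifted (generator T) l x = shifted (generator T) l y"
  then have "shifted (T t) (exp (complex_of_real t * l)) x = shifted (T t) (exp (complex_of_real t * l)) y"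
    using quotient_operator_shifted_generator[OF _ assms(1)] by metis
  then show "x = y" using assms(2) by (simp add: inj_eq)
qed

lemma range_shifted_subset:
  assumes "0 \<le> t"
  shows "range (shifted (T t) (exp (complex_of_real t * l))) \<subseteq> shifted (generator T) l ` generator_domain T"
  using quotient_operator_in_domain[OF assms] shifted_generator_quotient_operator[OF assms]
  by (metis imageI image_subsetI)

lemma bij_betw_shifted_generator:
  assumes "0 \<le> t" "bij (shifted (T t) (exp (complex_of_real t * l)))"
  shows "bij_betw (shifted (generator T) l) (generator_domain T) UNIV"
  using inj_on_shifted_generator[OF assms(1), of l] range_shifted_subset[OF assms(1), of l] assms(2)
  by (auto simp: bij_betw_def)

text \<open>The resolvent of the generator inherits continuity and bounds from that of \<open>T t\<close> through this
  factorization.\<close>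

lemma resolvent_generator:
  assumes t: "0 \<le> t" and bij: "bij (shifted (T t) (exp (complex_of_real t * l)))"
  shows "resolvent (generator_domain T) (generator T) l
    = quotient_operator l t \<circ> resolvent UNIV (T t) (exp (complex_of_real t * l))"
proof
  fix y
  define x where "x = resolvent UNIV (T t) (exp (complex_of_real t * l)) y"
  have "shifted (T t) (exp (complex_of_real t * l)) x = y"
    using bij by (simp add: x_def resolvent_def bij_is_surj surj_f_inv_f)
  then have "shifted (generator T) l (quotient_operator l t x) = y"
    by (simp add: shifted_generator_quotient_operator[OF t])
  then have "resolvent (generator_domain T) (generator T) l y = quotient_operator l t x"
    unfolding resolvent_def using bij_betw_shifted_generator[OF t bij]
    by (intro inv_into_f_eq quotient_operator_in_domain t) (simp_all add: bij_betw_def)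
  then show "resolvent (generator_domain T) (generator T) l y
      = (quotient_operator l t \<circ> resolvent UNIV (T t) (exp (complex_of_real t * l))) y"
    by (simp add: x_def)
qed

lemma closure_range_shifted_generator:
  assumes "0 \<le> t" "closure (range (shifted (T t) (exp (complex_of_real t * l)))) = UNIV"
  shows "closure (shifted (generator T) l ` generator_domain T) = UNIV"
  using closure_mono[OF range_shifted_subset[OF assms(1)], of l] assms(2) by auto

text \<open>One factor \<open>exp (t * cmod l)\<close> bounds the rescaling of the semigroup and the other that of the
  argument. The dependence on \<open>l\<close> is kept explicit because equicontinuity of resolvents near a
  point requires a bound that is locally uniform in \<open>l\<close>.\<close>

lemma quotient_operator_bound:
  assumes loc: "locally_equicontinuous \<Gamma> T" and q: "q \<in> \<Gamma>" and t: "0 \<le> t"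
  shows "\<exists>p\<in>\<Gamma>. \<exists>C\<ge>0. \<forall>l x. q (quotient_operator l t x) \<le> C * exp (2 * (t * cmod l)) * p x"
proof -
  obtain p C where p: "p \<in> \<Gamma>" and C: "0 \<le> C"
    and bound: "\<And>s x. s \<in> {0..t} \<Longrightarrow> q (T s x) \<le> C * p x"
    using loc q t unfolding locally_equicontinuous_def by blast
  have "q (quotient_operator l t x) \<le> (t * C) * exp (2 * (t * cmod l)) * p x" for l x
  proof -
    interpret U: semigroup_lc \<Gamma> "rescale l T" by (rule semigroup_lc_rescale)
    let ?E = "exp (t * cmod l)" and ?y = "exp (complex_of_real t * l) *\<^sub>C x"
    have exp_le: "cmod (exp (complex_of_real s * l)) \<le> ?E" if "\<bar>s\<bar> \<le> t" for s
    proof -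
      have "Re (complex_of_real s * l) \<le> cmod (complex_of_real s * l)" by (rule complex_Re_le_cmod)
      also have "\<dots> \<le> t * cmod l" using that by (simp add: norm_mult mult_right_mono)
      finally show ?thesis by (simp add: norm_exp_eq_Re)
    qed
    have y: "p ?y \<le> ?E * p x"
      using exp_le[of t] t nonneg[OF p] by (simp add: scale[OF p] mult_right_mono)
    have "q (rescale l T s ?y) \<le> ?E * (C * (?E * p x))" if s: "0 \<le> s" "s < t" for s
    proof -
      have "q (rescale l T s ?y) = cmod (exp (complex_of_real (- s) * l)) * q (T s ?y)"
        by (simp add: rescale_def scale[OF q])
      also have "\<dots> \<le> ?E * (C * (?E * p x))"
      proof (rule mult_mono)
        show "cmod (exp (complex_of_real (- s) * l)) \<le> ?E" using s by (intro exp_le) simp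
        show "q (T s ?y) \<le> C * (?E * p x)"
          using bound[of s ?y] s mult_left_mono[OF y C] by simp
      qed (simp_all add: nonneg[OF q])
      finally show ?thesis .
    qed
    then have "q (quotient_operator l t x) \<le> ?E * (C * (?E * p x)) * t"
      unfolding quotient_operator_def
      by (rule antiderivative_bound[OF U.antiderivative_orbit_integral q t])
    also have "\<dots> = (t * C) * (?E * ?E) * p x" by (simp add: mult_ac)
    also have "?E * ?E = exp (2 * (t * cmod l))" by (simp add: exp_add[symmetric])
    finally show ?thesis .
  qed
  then show ?thesis using p C t mult_nonneg_nonneg[OF t C] by blast
qed

lemma quotient_operator_continuous:
  assumes loc: "locally_equicontinuous \<Gamma> T" and t: "0 \<le> t"
  shows "quotient_operator l t \<in> continuous_operators"
proof (rule continuous_operatorI)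
  fix q assume "q \<in> \<Gamma>"
  then obtain p C where "p \<in> \<Gamma>" "0 \<le> C"
    "\<And>l x. q (quotient_operator l t x) \<le> C * exp (2 * (t * cmod l)) * p x"
    using quotient_operator_bound[OF loc _ t] by metis
  then show "\<exists>p\<in>\<Gamma>. \<exists>C\<ge>0. \<forall>x. q (quotient_operator l t x) \<le> C * p x"
    by (intro bexI[of _ p] exI[of _ "C * exp (2 * (t * cmod l))"]) auto
qed (rule quotient_operator_add[OF t] quotient_operator_scale[OF t])+

lemma resolvent_set_generator:
  assumes loc: "locally_equicontinuous \<Gamma> T" and t: "0 \<le> t"
    and l: "exp (complex_of_real t * l) \<in> resolvent_set UNIV (T t)"
  shows "l \<in> resolvent_set (generator_domain T) (generator T)"
  using l bij_betw_shifted_generator[OF t] resolvent_generator[OF t]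
    operator_comp[OF quotient_operator_continuous[OF loc t]]
  by (simp add: resolvent_set_def)

lemma star_resolvent_set_generator:
  assumes loc: "locally_equicontinuous \<Gamma> T" and t: "0 \<le> t"
    and l: "exp (complex_of_real t * l) \<in> star_resolvent_set \<Gamma> UNIV (T t)"
  shows "l \<in> star_resolvent_set \<Gamma> (generator_domain T) (generator T)"
proof -
  let ?e = "\<lambda>m. exp (complex_of_real t * m)"
  obtain \<epsilon> where \<epsilon>: "0 < \<epsilon>" "ball (?e l) \<epsilon> \<subseteq> resolvent_set UNIV (T t)"
    and equi: "equicontinuous \<Gamma> (resolvent UNIV (T t) ` ball (?e l) \<epsilon>)"
    using l unfolding star_resolvent_set_def by blast
  have "isCont ?e l" by (intro continuous_intros)
  then obtain d where d: "0 < d" "\<And>m. dist m l < d \<Longrightarrow> dist (?e m) (?e l) < \<epsilon>"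
    using \<epsilon>(1) unfolding continuous_at_eps_delta by metis
  \<comment> \<open>A bounded ball is needed for the factor \<open>exp (2 * (t * cmod m))\<close> to be bounded on it.\<close>
  define \<delta> where "\<delta> = min d 1"
  have e_ball: "?e m \<in> ball (?e l) \<epsilon>" if "m \<in> ball l \<delta>" for m
    using d(2)[of m] that by (simp add: \<delta>_def dist_commute)
  have sub: "ball l \<delta> \<subseteq> resolvent_set (generator_domain T) (generator T)"
    using e_ball \<epsilon>(2) resolvent_set_generator[OF loc t] by blast
  have "equicontinuous \<Gamma> (resolvent (generator_domain T) (generator T) ` ball l \<delta>)"
    unfolding equicontinuous_def
  proof (rule ballI)
    fix q assume "q \<in> \<Gamma>"
    then obtain p C where p: "p \<in> \<Gamma>" "0 \<le> C"
      and qp: "\<And>l x. q (quotient_operator l t x) \<le> C * exp (2 * (t * cmod l)) * p x"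
      using quotient_operator_bound[OF loc _ t] by metis
    obtain p' C' where p': "p' \<in> \<Gamma>" "0 \<le> C'"
      and pp': "\<And>m x. m \<in> ball (?e l) \<epsilon> \<Longrightarrow> p (resolvent UNIV (T t) m x) \<le> C' * p' x"
      using equi p(1) unfolding equicontinuous_def by blast
    let ?B = "C * exp (2 * (t * (cmod l + 1)))"
    have B: "0 \<le> ?B" using p(2) by simp
    have "q (resolvent (generator_domain T) (generator T) m x) \<le> ?B * C' * p' x"
      if m: "m \<in> ball l \<delta>" for m x
    proof -
      let ?y = "resolvent UNIV (T t) (?e m) x"
      have bij: "bij (shifted (T t) (?e m))"
        using e_ball[OF m] \<epsilon>(2) by (auto simp: resolvent_set_def)
      have "cmod m \<le> cmod l + 1"
        using m norm_triangle_ineq2[of m l] by (simp add: \<delta>_def dist_norm norm_minus_commute)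
      then have "C * exp (2 * (t * cmod m)) \<le> ?B"
        using t p(2) by (intro mult_left_mono[OF iffD2[OF exp_le_cancel_iff]] mult_left_mono) auto
      then have "C * exp (2 * (t * cmod m)) * p ?y \<le> ?B * (C' * p' x)"
        by (rule mult_mono[OF _ pp'[OF e_ball[OF m]] B nonneg[OF p(1)]])
      then show ?thesis
        using qp[of m ?y] by (simp add: resolvent_generator[OF t bij] mult.assoc)
    qed
    then show "\<exists>p\<in>\<Gamma>. \<exists>C\<ge>0. \<forall>S\<in>resolvent (generator_domain T) (generator T) ` ball l \<delta>.
        \<forall>x. q (S x) \<le> C * p x"
      using p' B by (intro bexI[of _ p'] exI[of _ "?B * C'"]) auto
  qed
  moreover have "0 < \<delta>" "l \<in> ball l \<delta>" using d(1) by (simp_all add: \<delta>_def)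
  ultimately show ?thesis using sub unfolding star_resolvent_set_def by blast
qed

text \<open>The same family serves for \<open>T t\<close>: the continuous quotient operator carries the null family
  \<open>(A - l) x\<^sub>i\<close> to \<open>(T(t) - e\<^bsup>tl\<^esup>) x\<^sub>i\<close>.\<close>

lemma approx_eigen_semigroup:
  assumes loc: "locally_equicontinuous \<Gamma> T" and t: "0 \<le> t"
    and dom: "eventually (\<lambda>i. x i \<in> generator_domain T) F"
    and x: "approx_eigen F x (generator T) l"
  shows "approx_eigen F x (T t) (exp (complex_of_real t * l))"
proof -
  note op = quotient_operator_continuous[OF loc t, of l]
  have zero: "quotient_operator l t 0 = 0"
    using operator_diff[OF op, of 0 0] by simp
  have "((\<lambda>i. quotient_operator l t (generator T (x i) - l *\<^sub>C x i)) \<longlongrightarrow> quotient_operator l t 0) F"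
    using x by (intro operator_tendsto[OF op]) (simp add: approx_eigen_def)
  moreover have "eventually (\<lambda>i. quotient_operator l t (generator T (x i) - l *\<^sub>C x i)
      = T t (x i) - exp (complex_of_real t * l) *\<^sub>C x i) F"
    using dom
  proof eventually_elim
    case (elim i)
    have "quotient_operator l t (generator T (x i) - l *\<^sub>C x i)
        = quotient_operator l t (0 - shifted (generator T) l (x i))"
      by (simp add: shifted_def)
    also have "\<dots> = 0 - shifted (T t) (exp (complex_of_real t * l)) (x i)"
      unfolding operator_diff[OF op] zero quotient_operator_shifted_generator[OF elim t] by (rule refl)
    finally show ?case by (simp add: shifted_def)
  qed
  ultimately have "((\<lambda>i. T t (x i) - exp (complex_of_real t * l) *\<^sub>C x i) \<longlongrightarrow> 0) F"
    unfolding zero by (rule Lim_transform_eventually)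
  then show ?thesis using x by (simp add: approx_eigen_def)
qed

lemma approx_eigen_net_semigroup:
  assumes "locally_equicontinuous \<Gamma> T" "0 \<le> t" "directed_preorder I r" "x ` I \<subseteq> generator_domain T"
    "approx_eigen (net_filter I r) x (generator T) l"
  shows "approx_eigen (net_filter I r) x (T t) (exp (complex_of_real t * l))"
proof (rule approx_eigen_semigroup[OF assms(1,2) _ assms(5)])
  show "eventually (\<lambda>i. x i \<in> generator_domain T) (net_filter I r)"
    using assms(3,4) unfolding eventually_net_filter[OF assms(3)] directed_preorder_def by blast
qed

lemma approx_eigen_sequence_semigroup:
  assumes "locally_equicontinuous \<Gamma> T" "0 \<le> t" "range x \<subseteq> generator_domain T"
    "approx_eigen sequentially x (generator T) l"
  shows "approx_eigen sequentially x (T t) (exp (complex_of_real t * l))"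
  using assms by (intro approx_eigen_semigroup always_eventually) auto

end

theorem theorem5p1:
  fixes \<Gamma> :: "('a::{complex_vector,t2_space} \<Rightarrow> real) set"
    and T :: "real \<Rightarrow> 'a \<Rightarrow> 'a"
  assumes "fundamental_seminorms \<Gamma>"
    and "sequentially_complete TYPE('a)"
    and "operator_semigroup T"
    and "strongly_continuous T"
  shows "(\<forall>t\<ge>0.
      exp_image t (alg_spectrum (generator_domain T) (generator T)) \<subseteq> alg_spectrum UNIV (T t) \<and>
      exp_image t (point_spectrum (generator_domain T) (generator T)) \<subseteq> point_spectrum UNIV (T t) \<and>
      exp_image t (residual_spectrum (generator_domain T) (generator T)) \<subseteq> residual_spectrum UNIV (T t)) \<and>
    (locally_equicontinuous \<Gamma> T \<longrightarrow> (\<forall>t\<ge>0.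
      exp_image t (spectrum (generator_domain T) (generator T)) \<subseteq> spectrum UNIV (T t) \<and>
      exp_image t (ap_spectrum (generator_domain T) (generator T)) \<subseteq> ap_spectrum UNIV (T t) \<and>
      exp_image t (ap_spectrum_seq (generator_domain T) (generator T)) \<subseteq> ap_spectrum_seq UNIV (T t) \<and>
      exp_image t (bap_spectrum \<Gamma> (generator_domain T) (generator T)) \<subseteq> bap_spectrum \<Gamma> UNIV (T t) \<and>
      exp_image t (bap_spectrum_seq \<Gamma> (generator_domain T) (generator T)) \<subseteq> bap_spectrum_seq \<Gamma> UNIV (T t) \<and>
      exp_image t (star_spectrum \<Gamma> (generator_domain T) (generator T)) \<subseteq> star_spectrum \<Gamma> UNIV (T t)))"
proof -
  interpret semigroup_lc \<Gamma> T
    using assms by unfold_locales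
  show ?thesis
  proof (intro conjI allI impI)
    fix t :: real assume t: "0 \<le> t"
    show "exp_image t (alg_spectrum (generator_domain T) (generator T)) \<subseteq> alg_spectrum UNIV (T t)"
      using bij_betw_shifted_generator[OF t] by (auto simp: exp_image_def alg_spectrum_def)
    show "exp_image t (point_spectrum (generator_domain T) (generator T)) \<subseteq> point_spectrum UNIV (T t)"
      using inj_on_shifted_generator[OF t] by (auto simp: exp_image_def point_spectrum_def)
    show "exp_image t (residual_spectrum (generator_domain T) (generator T)) \<subseteq> residual_spectrum UNIV (T t)"
      using closure_range_shifted_generator[OF t] by (auto simp: exp_image_def residual_spectrum_def)
  next
    fix t :: real assume loc: "locally_equicontinuous \<Gamma> T" and t: "0 \<le> t"
    show "exp_image t (spectrum (generator_domain T) (generator T)) \<subseteq> spectrum UNIV (T t)"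
      using resolvent_set_generator[OF loc t] by (auto simp: exp_image_def spectrum_def)
    show "exp_image t (star_spectrum \<Gamma> (generator_domain T) (generator T)) \<subseteq> star_spectrum \<Gamma> UNIV (T t)"
      using star_resolvent_set_generator[OF loc t] by (auto simp: exp_image_def star_spectrum_def)
    show "exp_image t (ap_spectrum (generator_domain T) (generator T)) \<subseteq> ap_spectrum UNIV (T t)"
      using approx_eigen_net_semigroup[OF loc t]
      unfolding exp_image_def ap_spectrum_def by blast
    show "exp_image t (bap_spectrum \<Gamma> (generator_domain T) (generator T)) \<subseteq> bap_spectrum \<Gamma> UNIV (T t)"
      using approx_eigen_net_semigroup[OF loc t]
      unfolding exp_image_def bap_spectrum_def by blast
    show "exp_image t (ap_spectrum_seq (generator_domain T) (generator T)) \<subseteq> ap_spectrum_seq UNIV (T t)"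
      using approx_eigen_sequence_semigroup[OF loc t]
      unfolding exp_image_def ap_spectrum_seq_def by blast
    show "exp_image t (bap_spectrum_seq \<Gamma> (generator_domain T) (generator T)) \<subseteq> bap_spectrum_seq \<Gamma> UNIV (T t)"
      using approx_eigen_sequence_semigroup[OF loc t]
      unfolding exp_image_def bap_spectrum_seq_def by blast
  qed
qed

end
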